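(* Suppose $S_0\ne\emptyset$ and $|S_3|\le n-l$. Then $\operatorname{conv}(\bar X^{l,u})$ is exactly the set of all $(\delta,z)\in\mathbb{R}^4\times\mathbb{R}^J$, $\delta=(\delta_0,\delta_1,\delta_2,\delta_3)$, satisfying all of the following linear inequalities. (A) $\delta_0\le 1$; $-\delta_3\le 0$; $\delta_3\le\delta_i$ for $i\in\{1,2\}$; $\delta_1+\delta_2\le\delta_0+\delta_3$. (B) $\sum_{j\in J}z_j\le u$; $z_j+\delta_i\le 1$ for $j\in S_i$, $i\in\{0,1,2\}$; $z_j\le 1$ for $j\in J$; $1-\delta_0-\sum_{j\in S_0}z_j\le 0$; $\delta_0-\delta_i-\sum_{j\in S_i\setminus S_0}z_j\le 0$ for $i\in\{1,2\}$; $-z_j\le 0$ for $j\in J$; $-\sum_{j\in J}z_j\le -l$. (C) For every $Q\subseteq J$: 1. $\sum_{j\in Q}z_j+(u-|Q\setminus S_0|)\delta_0+\sum_{i=1}^2|(Q\cap S_i)\setminus S_0|\,\delta_i\le u$, if $|Q\setminus S_0|\le u$; 2. $\sum_{j\in Q}z_j+\sum_{i=1}^2(u-|Q\setminus S_i|)\delta_i+(|Q\setminus S_0|-u)\delta_3\le u$; 3. $\sum_{j\in Q}z_j+\delta_0-\delta_i+(u-1-|Q\setminus S_k|)\delta_k+\delta_3\le u$, for every $(i,k)$ with $\{i,k\}=\{1,2\}$ and $Q\cap(S_i\setminus S_0)=\emptyset$; 4. $\sum_{j\in Q}z_j+(u-|Q\setminus S_i|)\delta_i+|(Q\cap S_3)\setminus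 S_i|\,\delta_3\le u$, for every $i\in\{1,2\}$ with $|Q\setminus S_i|\le u$; 5. $\sum_{j\in Q}z_j+(u-|Q\setminus S_3|)\delta_3\le u$, if $|Q\setminus S_3|\le u$. (D) For every $Q\subseteq J$: 1. $-\sum_{j\in Q}z_j+(l+|Q\cup S_0|-n)\delta_0+\sum_{i=1}^2|S_i\setminus (S_0\cup Q)|\,\delta_i\le 0$, if $|Q\cup S_0|\ge n-l$; 2. $-\sum_{j\in Q}z_j+\sum_{i=1}^2(l+|Q\cup S_i|-n)\delta_i+(n-|Q\cup S_0|-l)\delta_3\le 0$; 3. $-\sum_{j\in Q}z_j+\delta_0-\delta_i+(l+|Q\cup S_k|-1-n)\delta_k+\delta_3\le 0$, for every $(i,k)$ with $\{i,k\}=\{1,2\}$ and $S_i\setminus S_0\subseteq Q$; 4. $-\sum_{j\in Q}z_j+(l+|Q\cup S_i|-n)\delta_i+|S_3\setminus (S_i\cup Q)|\,\delta_3\le 0$, for every $i\in\{1,2\}$ with $|Q\cup S_i|\ge n-l$; 5. $-\sum_{j\in Q}z_j+(l+|Q\cup S_3|-n)\delta_3\le 0$, if $|Q\cup S_3|\ge n-l$.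
   Context: Setting: $J$ is a finite set with $|J|=n$; $l,u$ are integers with $l\ge 0$, $u\ge 2$, $u\ge l+1$; $S_1,S_2\subseteq J$ satisfy $2\le|S_i|\le n-l$ for $i\in\{1,2\}$, $S_1\setminus S_2\ne\emptyset$ and $S_2\setminus S_1\neq\emptyset$. Put $S_0:=S_1\cap S_2$ and $S_3:=S_1\cup S_2$. Define $$\bar X^{l,u}=\Big\{(\delta,z)\in\{0,1\}^4\times\{0,1\}^J:\ \delta_i=\prod_{j\in S_i}(1-z_j)\ (i=0,1,2,3),\ \ l\le\sum_{j\in J}z_j\le u\Big\},$$ where $\delta=(\delta_0,\delta_1,\delta_2,\delta_3)$. *)

theory Defs
  imports "HOL-Analysis.Analysis"
begin

(* The finite index set J is the type 'a, so J = UNIV and n = CARD('a).  The four components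
   delta_0, ..., delta_3 are indexed by the type 4, whose elements are 0, 1, 2, 3 (and 4 = 0). *)

definition S_fam :: "'a set \<Rightarrow> 'a set \<Rightarrow> 4 \<Rightarrow> 'a set" where
  "S_fam S1 S2 i =
     (if i = 0 then S1 \<inter> S2 else if i = 1 then S1 else if i = 2 then S2 else S1 \<union> S2)"

(* Cardinality as an integer, since differences of cardinalities and bounds may be negative. *)
abbreviation icard :: "'a set \<Rightarrow> int" where
  "icard A \<equiv> int (card A)"

definition X_bar :: "int \<Rightarrow> int \<Rightarrow> 'a::finite set \<Rightarrow> 'a set \<Rightarrow> ((real ^ 4) \<times> (real ^ 'a)) set" where
  "X_bar l u S1 S2 =
     {(\<delta>, z). (\<forall>i. \<delta> $ i \<in> {0, 1}) \<and> (\<forall>j. z $ j \<in> {0, 1}) \<and>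
        (\<forall>i. \<delta> $ i = (\<Prod>j\<in>S_fam S1 S2 i. 1 - z $ j)) \<and>
        of_int l \<le> (\<Sum>j\<in>UNIV. z $ j) \<and> (\<Sum>j\<in>UNIV. z $ j) \<le> of_int u}"

definition ineqs_A :: "real ^ 4 \<Rightarrow> bool" where
  "ineqs_A \<delta> \<longleftrightarrow>
     \<delta> $ 0 \<le> 1 \<and>
     - \<delta> $ 3 \<le> 0 \<and>
     (\<forall>i\<in>{1, 2}. \<delta> $ 3 \<le> \<delta> $ i) \<and>
     \<delta> $ 1 + \<delta> $ 2 \<le> \<delta> $ 0 + \<delta> $ 3"

definition ineqs_B ::
  "int \<Rightarrow> int \<Rightarrow> (4 \<Rightarrow> 'a::finite set) \<Rightarrow> real ^ 4 \<Rightarrow> real ^ 'a \<Rightarrow> bool" where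
  "ineqs_B l u S \<delta> z \<longleftrightarrow>
     (\<Sum>j\<in>UNIV. z $ j) \<le> of_int u \<and>
     (\<forall>i\<in>{0, 1, 2}. \<forall>j\<in>S i. z $ j + \<delta> $ i \<le> 1) \<and>
     (\<forall>j. z $ j \<le> 1) \<and>
     1 - \<delta> $ 0 - (\<Sum>j\<in>S 0. z $ j) \<le> 0 \<and>
     (\<forall>i\<in>{1, 2}. \<delta> $ 0 - \<delta> $ i - (\<Sum>j\<in>S i - S 0. z $ j) \<le> 0) \<and>
     (\<forall>j. - z $ j \<le> 0) \<and>
     - (\<Sum>j\<in>UNIV. z $ j) \<le> - of_int l"

definition ineqs_C ::
  "int \<Rightarrow> (4 \<Rightarrow> 'a::finite set) \<Rightarrow> real ^ 4 \<Rightarrow> real ^ 'a \<Rightarrow> 'a set \<Rightarrow> bool" where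
  "ineqs_C u S \<delta> z Q \<longleftrightarrow>
     (icard (Q - S 0) \<le> u \<longrightarrow>
        (\<Sum>j\<in>Q. z $ j) + of_int (u - icard (Q - S 0)) * \<delta> $ 0
          + (\<Sum>i\<in>{1, 2}. of_int (icard ((Q \<inter> S i) - S 0)) * \<delta> $ i) \<le> of_int u) \<and>
     (\<Sum>j\<in>Q. z $ j) + (\<Sum>i\<in>{1, 2}. of_int (u - icard (Q - S i)) * \<delta> $ i)
          + of_int (icard (Q - S 0) - u) * \<delta> $ 3 \<le> of_int u \<and>
     (\<forall>i k. {i, k} = {1, 2} \<and> Q \<inter> (S i - S 0) = {} \<longrightarrow>
        (\<Sum>j\<in>Q. z $ j) + \<delta> $ 0 - \<delta> $ i + of_int (u - 1 - icard (Q - S k)) * \<delta> $ k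
          + \<delta> $ 3 \<le> of_int u) \<and>
     (\<forall>i\<in>{1, 2}. icard (Q - S i) \<le> u \<longrightarrow>
        (\<Sum>j\<in>Q. z $ j) + of_int (u - icard (Q - S i)) * \<delta> $ i
          + of_int (icard ((Q \<inter> S 3) - S i)) * \<delta> $ 3 \<le> of_int u) \<and>
     (icard (Q - S 3) \<le> u \<longrightarrow>
        (\<Sum>j\<in>Q. z $ j) + of_int (u - icard (Q - S 3)) * \<delta> $ 3 \<le> of_int u)"

definition ineqs_D ::
  "int \<Rightarrow> (4 \<Rightarrow> 'a::finite set) \<Rightarrow> real ^ 4 \<Rightarrow> real ^ 'a \<Rightarrow> 'a set \<Rightarrow> bool" where
  "ineqs_D l S \<delta> z Q \<longleftrightarrow>
     (let n = int CARD('a) in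
     (icard (Q \<union> S 0) \<ge> n - l \<longrightarrow>
        - (\<Sum>j\<in>Q. z $ j) + of_int (l + icard (Q \<union> S 0) - n) * \<delta> $ 0
          + (\<Sum>i\<in>{1, 2}. of_int (icard (S i - (S 0 \<union> Q))) * \<delta> $ i) \<le> 0) \<and>
     - (\<Sum>j\<in>Q. z $ j) + (\<Sum>i\<in>{1, 2}. of_int (l + icard (Q \<union> S i) - n) * \<delta> $ i)
          + of_int (n - icard (Q \<union> S 0) - l) * \<delta> $ 3 \<le> 0 \<and>
     (\<forall>i k. {i, k} = {1, 2} \<and> S i - S 0 \<subseteq> Q \<longrightarrow>
        - (\<Sum>j\<in>Q. z $ j) + \<delta> $ 0 - \<delta> $ i + of_int (l + icard (Q \<union> S k) - 1 - n) * \<delta> $ k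
          + \<delta> $ 3 \<le> 0) \<and>
     (\<forall>i\<in>{1, 2}. icard (Q \<union> S i) \<ge> n - l \<longrightarrow>
        - (\<Sum>j\<in>Q. z $ j) + of_int (l + icard (Q \<union> S i) - n) * \<delta> $ i
          + of_int (icard (S 3 - (S i \<union> Q))) * \<delta> $ 3 \<le> 0) \<and>
     (icard (Q \<union> S 3) \<ge> n - l \<longrightarrow>
        - (\<Sum>j\<in>Q. z $ j) + of_int (l + icard (Q \<union> S 3) - n) * \<delta> $ 3 \<le> 0))"

end

theory Submission
  imports Defs
begin

text \<open>
  The vector \<open>\<delta>\<close> takes five values on the integer points, and these values are affinely
  independent; hence a point \<open>(\<delta>, z)\<close> determines the weight of each value in any convex
  representation. For a fixed value, \<open>z\<close> ranges over the sets of size between \<open>l\<close> and \<open>u\<close> that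
  avoid one set and hit the members of a disjoint family. The set of this kind with maximal
  weight \<open>c\<close> also maximises the size of the trace on every level set \<open>{c \<ge> t}\<close> with \<open>t > 0\<close>
  and minimises it on every \<open>{c \<le> t}\<close> with \<open>t < 0\<close>, as for generalised polymatroids. So if a
  hyperplane with normal \<open>(\<gamma>, -c)\<close> separates \<open>(\<delta>, z)\<close> from the hull, a layer-cake
  decomposition of \<open>c\<close> reduces the contradiction to bounds on \<open>z(Q)\<close> for single sets \<open>Q\<close>,
  and those follow from (A)-(D).
\<close>

section \<open>Level sets\<close>

text \<open>A nonnegative \<open>f\<close> is a nonnegative combination of indicators of its upper
  level sets. Each induction step peels off the indicator of the support, weighted by the least
  positive value of \<open>f\<close>, which shrinks the support.\<close>

lemma sum_mult_nonneg_of_level_sets: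
  fixes f d :: "'a::finite \<Rightarrow> real"
  assumes "\<And>j. 0 \<le> f j" and "\<And>t. 0 < t \<Longrightarrow> 0 \<le> sum d {j. t \<le> f j}"
  shows "0 \<le> (\<Sum>j\<in>UNIV. f j * d j)"
  using assms
proof (induction "card {j. f j \<noteq> 0}" arbitrary: f rule: less_induct)
  case less
  show ?case
  proof (cases "{j. f j \<noteq> 0} = {}")
    case True
    then show ?thesis by simp
  next
    case False
    define m where "m = Min (f ` {j. f j \<noteq> 0})"
    have "m \<in> f ` {j. f j \<noteq> 0}" using False unfolding m_def by (intro Min_in) auto
    then obtain k where k: "m = f k" "f k \<noteq> 0" by auto
    have m_pos: "0 < m" using k less.prems(1)[of k] by simp
    have m_le: "m \<le> f j" if "f j \<noteq> 0" for j using that unfolding m_def by auto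
    define g where "g j = f j - (if m \<le> f j then m else 0)" for j
    have g0: "0 \<le> g j" for j using less.prems(1)[of j] unfolding g_def by auto
    have sub: "{j. g j \<noteq> 0} \<subset> {j. f j \<noteq> 0}"
    proof
      show "{j. g j \<noteq> 0} \<subseteq> {j. f j \<noteq> 0}" using m_pos unfolding g_def by auto
      have "g k = 0" "f k \<noteq> 0" using k unfolding g_def by auto
      then show "{j. g j \<noteq> 0} \<noteq> {j. f j \<noteq> 0}" by auto
    qed
    have "0 \<le> sum d {j. t \<le> g j}" if "0 < t" for t
    proof -
      \<comment> \<open>Subtracting \<open>m\<close> on the whole support only shifts heights:
        positive levels of \<open>g\<close> are levels of \<open>f\<close> above
        \<open>m\<close>.\<close>
      have "t \<le> g j \<longleftrightarrow> t + m \<le> f j" for j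
        using that m_pos m_le[of j] unfolding g_def by auto
      then have "{j. t \<le> g j} = {j. t + m \<le> f j}" by simp
      then show ?thesis using less.prems(2)[of "t + m"] that m_pos by simp
    qed
    then have "0 \<le> (\<Sum>j\<in>UNIV. g j * d j)"
      using less.hyps[of g] psubset_card_mono[OF _ sub] g0 by simp
    moreover have "(\<Sum>j\<in>UNIV. f j * d j) = (\<Sum>j\<in>UNIV. g j * d j) + m * sum d {j. m \<le> f j}"
    proof -
      have "m * sum d {j. m \<le> f j} = (\<Sum>j\<in>UNIV. if m \<le> f j then m * d j else 0)"
        by (simp add: sum_distrib_left flip: sum.inter_filter)
      then show ?thesis
        by (simp flip: sum.distrib) (auto intro!: sum.cong simp: g_def algebra_simps)
    qed
    ultimately show ?thesis using less.prems(2)[OF m_pos] m_pos by simp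
  qed
qed

text \<open>Split \<open>c\<close> into positive and negative part and apply the previous lemma to
  \<open>y - x\<close> and to \<open>x - y\<close>. Level 0 never enters, so the totals of
  \<open>x\<close> and \<open>y\<close> may differ.\<close>

lemma sum_mult_le_of_level_sets:
  fixes c x y :: "'a::finite \<Rightarrow> real"
  assumes up: "\<And>t. 0 < t \<Longrightarrow> sum x {j. t \<le> c j} \<le> sum y {j. t \<le> c j}"
    and lo: "\<And>t. t < 0 \<Longrightarrow> sum y {j. c j \<le> t} \<le> sum x {j. c j \<le> t}"
  shows "(\<Sum>j\<in>UNIV. c j * x j) \<le> (\<Sum>j\<in>UNIV. c j * y j)"
proof -
  have "0 \<le> (\<Sum>j\<in>UNIV. max (c j) 0 * (y j - x j))"
  proof (rule sum_mult_nonneg_of_level_sets)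
    fix t :: real assume "0 < t"
    then have "{j. t \<le> max (c j) 0} = {j. t \<le> c j}" by auto
    then show "0 \<le> (\<Sum>j\<in>{j. t \<le> max (c j) 0}. y j - x j)"
      using up[OF \<open>0 < t\<close>] by (simp add: sum_subtractf)
  qed simp
  moreover have "0 \<le> (\<Sum>j\<in>UNIV. max (- c j) 0 * (x j - y j))"
  proof (rule sum_mult_nonneg_of_level_sets)
    fix t :: real assume "0 < t"
    then have "{j. t \<le> max (- c j) 0} = {j. c j \<le> - t}" by auto
    then show "0 \<le> (\<Sum>j\<in>{j. t \<le> max (- c j) 0}. x j - y j)"
      using lo[of "- t"] \<open>0 < t\<close> by (simp add: sum_subtractf)
  qed simp
  ultimately have "0 \<le> (\<Sum>j\<in>UNIV. max (c j) 0 * (y j - x j) + max (- c j) 0 * (x j - y j))"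
    by (simp add: sum.distrib)
  also have "\<dots> = (\<Sum>j\<in>UNIV. c j * y j - c j * x j)"
    by (intro sum.cong) (auto simp: max_def algebra_simps)
  finally show ?thesis by (simp add: sum_subtractf)
qed

section \<open>Sets of bounded size hitting a disjoint family\<close>

text \<open>Each of the five values of \<open>\<delta>\<close> prescribes such a system:
  \<open>Z\<close> is the union of the sets whose component of \<open>\<delta>\<close> is 1, and
  \<open>\<T>\<close> lists the pieces that must then be met.\<close>

definition hitting_sets :: "int \<Rightarrow> int \<Rightarrow> 'a set \<Rightarrow> 'a set set \<Rightarrow> 'a set set" where
  "hitting_sets l u Z \<T> =
     {A. A \<inter> Z = {} \<and> l \<le> icard A \<and> icard A \<le> u \<and> (\<forall>T\<in>\<T>. A \<inter> T \<noteq> {})}"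

section \<open>Exchange between two hitting sets\<close>

lemma icard_exchange:
  fixes A :: "'a::finite set"
  assumes "j \<in> A" "i \<notin> A"
  shows "icard (insert i (A - {j})) = icard A"
proof -
  have "card A > 0" using assms by (auto simp: card_gt_0_iff)
  then show ?thesis using assms by (simp add: card.insert_remove card_Diff_singleton)
qed

lemma hitting_sets_exchange:
  fixes A B W Z :: "'a::finite set"
  assumes disj: "disjoint \<T>" and A: "A \<in> hitting_sets l u Z \<T>" and B: "B \<in> hitting_sets l u Z \<T>"
    and less: "card (B \<inter> W) < card (A \<inter> W)"
  obtains j where "j \<in> A \<inter> W" "\<And>T. T \<in> \<T> \<Longrightarrow> A \<inter> T \<noteq> {j}"
  | i j where "j \<in> A \<inter> W" "i \<in> B - A - W" "insert i (A - {j}) \<in> hitting_sets l u Z \<T>"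
proof -
  have absurd: False if no1: "\<And>j. j \<in> A \<inter> W \<Longrightarrow> \<exists>T\<in>\<T>. A \<inter> T = {j}"
    and no2: "\<And>i j. j \<in> A \<inter> W \<Longrightarrow> i \<in> B - A - W \<Longrightarrow> insert i (A - {j}) \<notin> hitting_sets l u Z \<T>"
  proof -
    obtain T where T: "\<And>j. j \<in> A \<inter> W \<Longrightarrow> T j \<in> \<T> \<and> A \<inter> T j = {j}" using no1 by metis
    have "\<exists>b. b \<in> B \<inter> W \<inter> T j" if j: "j \<in> A \<inter> W" for j
    proof -
      obtain i where i: "i \<in> B" "i \<in> T j" using B T[OF j] unfolding hitting_sets_def by blast
      have "i \<in> W"
      proof (rule ccontr)
        assume "i \<notin> W"
        have "i \<notin> A" using i T[OF j] j \<open>i \<notin> W\<close> by auto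
        have cd: "icard (insert i (A - {j})) = icard A"
          using \<open>i \<notin> A\<close> j by (intro icard_exchange) auto
        \<comment> \<open>The new point \<open>i\<close> takes over the hit of \<open>T j\<close>;
          every other member misses \<open>j\<close> by disjointness and keeps its hit.\<close>
        have "insert i (A - {j}) \<inter> T' \<noteq> {}" if "T' \<in> \<T>" for T'
        proof (cases "T' = T j")
          case False
          then have "j \<notin> T'" using disj T[OF j] that unfolding disjoint_def by blast
          then show ?thesis using A that unfolding hitting_sets_def by blast
        qed (use i in auto)
        then have "insert i (A - {j}) \<in> hitting_sets l u Z \<T>"
          using A B i cd unfolding hitting_sets_def by auto
        then show False using no2[OF j] i \<open>i \<notin> A\<close> \<open>i \<notin> W\<close> by blast
      qed
      then show ?thesis using i by blast
    qed
    then obtain b where b: "\<And>j. j \<in> A \<inter> W \<Longrightarrow> b j \<in> B \<inter> W \<inter> T j" by metis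
    have "inj_on b (A \<inter> W)"
    proof
      fix j k assume jk: "j \<in> A \<inter> W" "k \<in> A \<inter> W" "b j = b k"
      then have "b k \<in> T j \<inter> T k" using b[OF jk(1)] b[OF jk(2)] by simp
      then have eq: "T j = T k" using disj T[OF jk(1)] T[OF jk(2)] unfolding disjoint_def by blast
      have "{j} = {k}" using T[OF jk(1)] T[OF jk(2)] unfolding eq by metis
      then show "j = k" by simp
    qed
    moreover have "b ` (A \<inter> W) \<subseteq> B \<inter> W" using b by blast
    ultimately have "card (A \<inter> W) \<le> card (B \<inter> W)" by (meson card_inj_on_le finite)
    then show False using less by simp
  qed
  show thesis
  proof (rule ccontr)
    assume no: "\<not> thesis"
    show False
    proof (rule absurd)
      show "\<exists>T\<in>\<T>. A \<inter> T = {j}" if "j \<in> A \<inter> W" for j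
        using \<open>\<And>j. j \<in> A \<inter> W \<Longrightarrow> (\<And>T. T \<in> \<T> \<Longrightarrow> A \<inter> T \<noteq> {j}) \<Longrightarrow> thesis\<close>[OF that] no by metis
      show "insert i (A - {j}) \<notin> hitting_sets l u Z \<T>" if "j \<in> A \<inter> W" "i \<in> B - A - W" for i j
        using \<open>\<And>i j. j \<in> A \<inter> W \<Longrightarrow> i \<in> B - A - W \<Longrightarrow>
          insert i (A - {j}) \<in> hitting_sets l u Z \<T> \<Longrightarrow> thesis\<close>[OF that] no by metis
    qed
  qed
qed

section \<open>Traces of a maximiser on level sets\<close>

lemma sum_exchange:
  fixes c :: "'a::finite \<Rightarrow> real"
  assumes "j \<in> A" "i \<notin> A"
  shows "sum c (insert i (A - {j})) = sum c A + c i - c j"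
  using assms by (simp add: sum_diff1)

text \<open>If \<open>B\<close> had the larger trace on the level set, some \<open>i\<close> of
  \<open>B\<close> in it would be missing from \<open>A\<close>. Either \<open>A\<close> has room
  for \<open>i\<close>, which gains weight since \<open>t > 0\<close>, or \<open>A\<close> is full,
  so it has more points than \<open>B\<close> below level \<open>t\<close>, and the exchange lemma
  trades one of these for a point of weight at least \<open>t\<close>.\<close>

lemma maximizer_upper_level_set:
  fixes c :: "'a::finite \<Rightarrow> real" and Z :: "'a set"
  assumes disj: "disjoint \<T>" and A: "A \<in> hitting_sets l u Z \<T>"
    and max: "\<And>B. B \<in> hitting_sets l u Z \<T> \<Longrightarrow> sum c B \<le> sum c A"
    and B: "B \<in> hitting_sets l u Z \<T>" and t: "0 < t"
  shows "card (B \<inter> {j. t \<le> c j}) \<le> card (A \<inter> {j. t \<le> c j})"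
proof (rule ccontr)
  define U where "U = {j. t \<le> c j}"
  assume "\<not> ?thesis"
  then have lt: "card (A \<inter> U) < card (B \<inter> U)" by (simp add: U_def)
  then have "\<not> B \<inter> U \<subseteq> A \<inter> U" by (meson card_mono finite leD)
  then obtain i where i: "i \<in> B" "i \<in> U" "i \<notin> A" by blast
  show False
  proof (cases "icard A < u")
    case True
    then have "insert i A \<in> hitting_sets l u Z \<T>"
      using A B i unfolding hitting_sets_def by auto
    from max[OF this] show False using i t by (simp add: U_def)
  next
    case False
    then have "icard A = u" using A unfolding hitting_sets_def by auto
    moreover have "icard B \<le> u" using B unfolding hitting_sets_def by auto
    moreover have "card A = card (A \<inter> U) + card (A \<inter> - U)" "card B = card (B \<inter> U) + card (B \<inter> - U)"
      using card_Int_Diff[of A U] card_Int_Diff[of B U] by (simp_all add: Diff_eq)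
    \<comment> \<open>The exchange is applied with \<open>W = - U\<close>: the point given up lies
      below level \<open>t\<close>, the point gained does not.\<close>
    ultimately have "card (B \<inter> - U) < card (A \<inter> - U)" using lt by linarith
    from disj A B this show False
    proof (cases rule: hitting_sets_exchange)
      case (1 j)
      have "insert i (A - {j}) \<inter> T \<noteq> {}" if "T \<in> \<T>" for T
        using 1(2)[OF that] A that unfolding hitting_sets_def by blast
      then have "insert i (A - {j}) \<in> hitting_sets l u Z \<T>"
        using A B i 1(1) icard_exchange[of j A i] unfolding hitting_sets_def by auto
      from max[OF this] show False using i 1(1) sum_exchange[of j A i c] by (simp add: U_def)
    next
      case (2 i j)
      from max[OF 2(3)] show False using 2(1,2) sum_exchange[of j A i c] by (simp add: U_def)
    qed
  qed
qed

text \<open>Mirror image of the upper case, with the exchange applied to the lower level set itself.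
  A droppable point of negative weight is deleted while \<open>A\<close> has more than
  \<open>l\<close> elements; at size exactly \<open>l\<close> it is replaced by a point of
  \<open>B\<close> above level \<open>t\<close>.\<close>

lemma maximizer_lower_level_set:
  fixes c :: "'a::finite \<Rightarrow> real" and Z :: "'a set"
  assumes disj: "disjoint \<T>" and A: "A \<in> hitting_sets l u Z \<T>"
    and max: "\<And>B. B \<in> hitting_sets l u Z \<T> \<Longrightarrow> sum c B \<le> sum c A"
    and B: "B \<in> hitting_sets l u Z \<T>" and t: "t < 0"
  shows "card (A \<inter> {j. c j \<le> t}) \<le> card (B \<inter> {j. c j \<le> t})"
proof (rule ccontr)
  define L where "L = {j. c j \<le> t}"
  assume "\<not> ?thesis"
  then have lt: "card (B \<inter> L) < card (A \<inter> L)" by (simp add: L_def)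
  from disj A B lt show False
  proof (cases rule: hitting_sets_exchange)
    case (1 j)
    show False
    proof (cases "l < icard A")
      case True
      have "(A - {j}) \<inter> T \<noteq> {}" if "T \<in> \<T>" for T
        using 1(2)[OF that] A that unfolding hitting_sets_def by blast
      then have "A - {j} \<in> hitting_sets l u Z \<T>"
        using A True 1(1) unfolding hitting_sets_def by auto
      from max[OF this] show False using 1(1) t by (simp add: L_def sum_diff1)
    next
      case False
      then have "icard A = l" using A unfolding hitting_sets_def by auto
      moreover have "l \<le> icard B" using B unfolding hitting_sets_def by auto
      moreover have "card A = card (A \<inter> L) + card (A \<inter> - L)" "card B = card (B \<inter> L) + card (B \<inter> - L)"
        using card_Int_Diff[of A L] card_Int_Diff[of B L] by (simp_all add: Diff_eq)
      ultimately have "card (A \<inter> - L) < card (B \<inter> - L)" using lt by linarith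
      then have "\<not> B \<inter> - L \<subseteq> A \<inter> - L" by (meson card_mono finite leD)
      then obtain i where i: "i \<in> B" "i \<notin> L" "i \<notin> A" by blast
      have "insert i (A - {j}) \<inter> T \<noteq> {}" if "T \<in> \<T>" for T
        using 1(2)[OF that] A that unfolding hitting_sets_def by blast
      then have "insert i (A - {j}) \<in> hitting_sets l u Z \<T>"
        using A B i 1(1) icard_exchange[of j A i] unfolding hitting_sets_def by auto
      from max[OF this] show False using i 1(1) sum_exchange[of j A i c] by (simp add: L_def)
    qed
  next
    case (2 i j)
    from max[OF 2(3)] show False using 2(1,2) sum_exchange[of j A i c] by (simp add: L_def)
  qed
qed

section \<open>Existence of hitting sets with a large trace\<close>

lemma obtain_card_between:
  fixes H D :: "'a::finite set"
  assumes "H \<subseteq> D" "icard H \<le> k" "k \<le> icard D"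
  obtains C where "H \<subseteq> C" "C \<subseteq> D" "icard C = k"
proof -
  have "card H \<le> nat k" "nat k \<le> card D" "0 \<le> k" using assms by auto
  then show thesis using exists_subset_between[of H "nat k" D] assms that by auto
qed

text \<open>Pick a representative of every member of \<open>\<T>\<close>, inside \<open>R\<close>
  whenever possible; exactly \<open>m\<close> of them are forced outside \<open>R\<close>. Fill up
  inside \<open>R\<close> as far as the remaining capacity \<open>u - m\<close> allows, then pad to
  size \<open>l\<close> if necessary. One set \<open>B\<close> thus has both a large trace on
  \<open>R\<close> and a small trace off \<open>R\<close>.\<close>

lemma hitting_set_exists:
  fixes R Z :: "'a::finite set"
  assumes disj: "disjoint \<T>" and ne: "{} \<notin> \<T>" and avoid: "\<And>T. T \<in> \<T> \<Longrightarrow> T \<inter> Z = {}"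
    and lu: "l \<le> u" and cu: "icard \<T> \<le> u" and lZ: "l \<le> icard (- Z)"
  defines "m \<equiv> icard {T \<in> \<T>. R \<inter> T = {}}"
  obtains B where "B \<in> hitting_sets l u Z \<T>"
    "min (icard (R - Z)) (u - m) \<le> icard (B \<inter> R)" "icard (B - R) \<le> max m (l - icard (R - Z))"
proof -
  have "\<exists>x. x \<in> T \<and> (R \<inter> T \<noteq> {} \<longrightarrow> x \<in> R)" if "T \<in> \<T>" for T
    using ne that by (cases "R \<inter> T = {}") auto
  then obtain x where x: "\<And>T. T \<in> \<T> \<Longrightarrow> x T \<in> T" "\<And>T. T \<in> \<T> \<Longrightarrow> R \<inter> T \<noteq> {} \<Longrightarrow> x T \<in> R"
    by metis
  have inj: "inj_on x \<T>" using disj x(1) unfolding disjoint_def inj_on_def by (metis IntI empty_iff)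
  define M where "M = x ` {T \<in> \<T>. R \<inter> T = {}}"
  define H where "H = x ` {T \<in> \<T>. R \<inter> T \<noteq> {}}"
  have cM: "icard M = m" unfolding M_def m_def using inj by (simp add: card_image inj_on_def)
  have MR: "M \<inter> R = {}" unfolding M_def using x(1) by blast
  have MZ: "M \<inter> Z = {}" unfolding M_def using x(1) avoid by blast
  have HR: "H \<subseteq> R - Z" unfolding H_def using x avoid by blast
  have "H \<union> M = x ` \<T>" unfolding H_def M_def by blast
  then have "icard (H \<union> M) = icard \<T>" using inj by (simp add: card_image)
  then have HM: "icard H + m = icard \<T>" using cM MR HR by (subst (asm) card_Un_disjoint) auto
  have "icard H \<le> icard (R - Z)" using HR by (simp add: card_mono)
  \<comment> \<open>The target size is at least that of \<open>H\<close> because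
    \<open>icard H + m = icard \<T> \<le> u\<close>.\<close>
  then obtain C where C: "H \<subseteq> C" "C \<subseteq> R - Z" "icard C = min (icard (R - Z)) (u - m)"
    using obtain_card_between[OF HR, of "min (icard (R - Z)) (u - m)"] HM cu by auto
  have cCM: "icard (C \<union> M) = icard C + m" using C MR cM by (subst card_Un_disjoint) auto
  have CMZ: "C \<union> M \<subseteq> - Z" using C MZ by blast
  have "icard (C \<union> M) \<le> icard (- Z)" using CMZ by (simp add: card_mono)
  then obtain B where B: "C \<union> M \<subseteq> B" "B \<subseteq> - Z" "icard B = max l (icard (C \<union> M))"
    using obtain_card_between[OF CMZ, of "max l (icard (C \<union> M))"] lZ by auto
  have "B \<inter> T \<noteq> {}" if "T \<in> \<T>" for T
  proof -
    have "x T \<in> H \<union> M" using that unfolding H_def M_def by blast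
    then show ?thesis using B C x(1)[OF that] by blast
  qed
  then have "B \<in> hitting_sets l u Z \<T>"
    using B C cCM lu unfolding hitting_sets_def by auto
  moreover have CB: "icard C \<le> icard (B \<inter> R)"
    using B C by (intro of_nat_mono card_mono) auto
  moreover have "icard B = icard (B \<inter> R) + icard (B - R)"
    by (metis card_Int_Diff finite of_nat_add)
  \<comment> \<open>Off \<open>R\<close> there are at most
    \<open>max l (icard C + m) - icard C\<close> points. If the capacity limits \<open>C\<close>,
    then \<open>l - icard C \<le> m\<close> follows from \<open>l \<le> u\<close>.\<close>
  ultimately show thesis using that B C cCM lu by (simp add: min_def max_def split: if_splits)
qed

text \<open>A single maximiser \<open>A\<close> competes, at each level separately, with the set
  built for that level. The lower bound is written with \<open>l - icard (A \<inter> ...)\<close>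
  and the complement of the level set so that it has the shape of the upper one with
  \<open>l\<close> in place of \<open>u\<close>; this matches the common form of (C) and
  (D).\<close>

lemma hitting_set_maximizer:
  fixes c :: "'a::finite \<Rightarrow> real" and Z :: "'a set" and m :: "'a set \<Rightarrow> int"
  assumes "disjoint \<T>" "{} \<notin> \<T>" "\<And>T. T \<in> \<T> \<Longrightarrow> T \<inter> Z = {}"
    "l \<le> u" "icard \<T> \<le> u" "l \<le> icard (- Z)"
    and m: "\<And>R. icard {T \<in> \<T>. R \<inter> T = {}} = m R"
  shows "\<exists>A \<in> hitting_sets l u Z \<T>.
    (\<forall>t>0. min (icard ({j. t \<le> c j} - Z)) (u - m {j. t \<le> c j}) \<le> icard (A \<inter> {j. t \<le> c j})) \<and>
    (\<forall>t<0. min (icard (- {j. c j \<le> t} - Z)) (l - m (- {j. c j \<le> t}))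
       \<le> l - icard (A \<inter> {j. c j \<le> t}))"
proof -
  let ?P = "hitting_sets l u Z \<T>"
  note ex = hitting_set_exists[OF assms(1-6), unfolded m]
  have "?P \<noteq> {}" using ex[of UNIV] by blast
  then have "Max (sum c ` ?P) \<in> sum c ` ?P" by (intro Max_in) auto
  then obtain A where A: "A \<in> ?P" and "sum c A = Max (sum c ` ?P)" by auto
  then have max: "sum c B \<le> sum c A" if "B \<in> ?P" for B using that by simp
  show ?thesis
  proof (intro bexI[OF _ A] conjI allI impI)
    fix t :: real assume t: "0 < t"
    define U where "U = {j. t \<le> c j}"
    obtain B where B: "B \<in> ?P" "min (icard (U - Z)) (u - m U) \<le> icard (B \<inter> U)"
      using ex[of U] by blast
    have "icard (B \<inter> U) \<le> icard (A \<inter> U)"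
      using maximizer_upper_level_set[OF assms(1) A max B(1) t] unfolding U_def by simp
    then show "min (icard ({j. t \<le> c j} - Z)) (u - m {j. t \<le> c j}) \<le> icard (A \<inter> {j. t \<le> c j})"
      using B(2) unfolding U_def by linarith
  next
    fix t :: real assume t: "t < 0"
    define L where "L = {j. c j \<le> t}"
    obtain B where B: "B \<in> ?P" "icard (B - - L) \<le> max (m (- L)) (l - icard (- L - Z))"
      using ex[of "- L"] by blast
    have "icard (B - - L) = icard (B \<inter> L)" by (simp add: Diff_eq)
    moreover have "icard (A \<inter> L) \<le> icard (B \<inter> L)"
      using maximizer_lower_level_set[OF assms(1) A max B(1) t] unfolding L_def by simp
    ultimately show "min (icard (- {j. c j \<le> t} - Z)) (l - m (- {j. c j \<le> t}))
       \<le> l - icard (A \<inter> {j. c j \<le> t})" using B(2) unfolding L_def by linarith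
  qed
qed

section \<open>The cardinality cuts\<close>

text \<open>
  Common form of (C) and (D): with \<open>x = z(Q)\<close> and \<open>v = u\<close> this is (C) for \<open>Q\<close>, with
  \<open>x = l - z(- Q)\<close> and \<open>v = l\<close> it is (D) for \<open>- Q\<close>.
\<close>

definition valid_cuts ::
  "'a set \<Rightarrow> 'a set \<Rightarrow> int \<Rightarrow> 'a set \<Rightarrow> real \<Rightarrow> real \<Rightarrow> real \<Rightarrow> real \<Rightarrow> real \<Rightarrow> bool" where
  "valid_cuts S1 S2 v Q d0 d1 d2 d3 x \<longleftrightarrow>
     (icard (Q - S1 \<inter> S2) \<le> v \<longrightarrow> x + of_int (v - icard (Q - S1 \<inter> S2)) * d0
        + of_int (icard (Q \<inter> S1 - S2)) * d1 + of_int (icard (Q \<inter> S2 - S1)) * d2 \<le> of_int v) \<and>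
     x + of_int (v - icard (Q - S1)) * d1 + of_int (v - icard (Q - S2)) * d2
        + of_int (icard (Q - S1 \<inter> S2) - v) * d3 \<le> of_int v \<and>
     (Q \<inter> (S1 - S2) = {} \<longrightarrow>
        x + d0 - d1 + of_int (v - 1 - icard (Q - S2)) * d2 + d3 \<le> of_int v) \<and>
     (Q \<inter> (S2 - S1) = {} \<longrightarrow>
        x + d0 - d2 + of_int (v - 1 - icard (Q - S1)) * d1 + d3 \<le> of_int v) \<and>
     (icard (Q - S1) \<le> v \<longrightarrow>
        x + of_int (v - icard (Q - S1)) * d1 + of_int (icard (Q \<inter> S2 - S1)) * d3 \<le> of_int v) \<and>
     (icard (Q - S2) \<le> v \<longrightarrow>
        x + of_int (v - icard (Q - S2)) * d2 + of_int (icard (Q \<inter> S1 - S2)) * d3 \<le> of_int v) \<and>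
     (icard (Q - (S1 \<union> S2)) \<le> v \<longrightarrow> x + of_int (v - icard (Q - (S1 \<union> S2))) * d3 \<le> of_int v)"

lemma valid_cuts_swap:
  "valid_cuts S1 S2 v Q d0 d1 d2 d3 x \<Longrightarrow> valid_cuts S2 S1 v Q d0 d2 d1 d3 x"
  unfolding valid_cuts_def Int_commute[of S2 S1] Un_commute[of S2 S1] by (simp add: algebra_simps)

text \<open>
  The coefficients are the weights of the five values (0,0,0,0), (1,0,0,0), (1,1,0,0),
  (1,0,1,0), (1,1,1,1) of \<open>\<delta>\<close> in a convex combination equal to \<open>(d0, d1, d2, d3)\<close>.
\<close>

definition pattern_sum ::
  "real \<Rightarrow> real \<Rightarrow> real \<Rightarrow> real \<Rightarrow> int \<Rightarrow> int \<Rightarrow> int \<Rightarrow> int \<Rightarrow> int \<Rightarrow> real" where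
  "pattern_sum d0 d1 d2 d3 b0 b1 b2 b3 b4 = (1 - d0) * of_int b0 + (d0 - d1 - d2 + d3) * of_int b1
     + (d1 - d3) * of_int b2 + (d2 - d3) * of_int b3 + d3 * of_int b4"

text \<open>A missed \<open>T\<close> forces a point outside \<open>Q\<close> on every set hitting
  \<open>T\<close>; for disjoint pieces these losses add up and are subtracted from the
  capacity.\<close>

definition missed :: "'a set \<Rightarrow> 'a set \<Rightarrow> int" where
  "missed Q T = of_bool (Q \<inter> T = {})"

section \<open>Upper bounds on \<open>F\<close> obtained from the cuts\<close>

lemma icard_split:
  fixes Q S1 S2 :: "'a::finite set"
  shows "icard (Q - S1) = icard (Q \<inter> S2 - S1) + icard (Q - (S1 \<union> S2))"
    "icard (Q - S2) = icard (Q \<inter> S1 - S2) + icard (Q - (S1 \<union> S2))"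
    "icard (Q - S1 \<inter> S2) = icard (Q \<inter> S1 - S2) + icard (Q \<inter> S2 - S1) + icard (Q - (S1 \<union> S2))"
    "icard Q = icard (Q \<inter> S1 \<inter> S2) + icard (Q - S1 \<inter> S2)"
proof -
  have split: "icard A = icard B + icard C" if "A = B \<union> C" "B \<inter> C = {}" for A B C :: "'a set"
    using that by (simp add: card_Un_disjoint)
  show "icard (Q - S1) = icard (Q \<inter> S2 - S1) + icard (Q - (S1 \<union> S2))" by (rule split) blast+
  show e: "icard (Q - S2) = icard (Q \<inter> S1 - S2) + icard (Q - (S1 \<union> S2))" by (rule split) blast+
  have "icard (Q - S1 \<inter> S2) = icard (Q \<inter> S2 - S1) + icard (Q - S2)" by (rule split) blast+
  with e show "icard (Q - S1 \<inter> S2)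
    = icard (Q \<inter> S1 - S2) + icard (Q \<inter> S2 - S1) + icard (Q - (S1 \<union> S2))" by linarith
  show "icard Q = icard (Q \<inter> S1 \<inter> S2) + icard (Q - S1 \<inter> S2)" by (rule split) blast+
qed

text \<open>Covers both sides at once: \<open>F Q = z(Q)\<close> with \<open>v = u\<close>, and
  \<open>F Q = l - z(- Q)\<close> with \<open>v = l\<close>. In both cases enlarging the argument by
  a disjoint \<open>T\<close> adds \<open>z(T)\<close>, which is all that the arguments below need
  to know about how \<open>F\<close> varies.\<close>

locale cut_system =
  fixes S1 S2 :: "'a::finite set" and d0 d1 d2 d3 :: real
    and z :: "'a \<Rightarrow> real" and F :: "'a set \<Rightarrow> real" and v :: int
  assumes ne: "S1 \<inter> S2 \<noteq> {}"
    and d: "d0 \<le> 1" "0 \<le> d3" "d3 \<le> d1" "d3 \<le> d2" "d1 + d2 \<le> d0 + d3"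
    and F_Un: "\<And>R T. R \<inter> T = {} \<Longrightarrow> F (R \<union> T) = F R + sum z T"
    and F_le: "\<And>R. F R \<le> of_int v"
    and F_le_sum: "\<And>R. F R \<le> sum z R"
    and z_le: "\<And>j. z j \<le> 1" "\<And>j. j \<in> S1 \<inter> S2 \<Longrightarrow> z j \<le> 1 - d0"
      "\<And>j. j \<in> S1 \<Longrightarrow> z j \<le> 1 - d1" "\<And>j. j \<in> S2 \<Longrightarrow> z j \<le> 1 - d2"
    and sum_ge: "1 - d0 \<le> sum z (S1 \<inter> S2)" "d0 - d1 \<le> sum z (S1 - S2)" "d0 - d2 \<le> sum z (S2 - S1)"
    and cuts: "\<And>Q. valid_cuts S1 S2 v Q d0 d1 d2 d3 (F Q)"
begin

text \<open>The cut for \<open>Q\<close> disjoint from \<open>S2 - S1\<close> gets no name; it is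
  reached through \<open>swap\<close>.\<close>

lemmas cut0 = cuts[unfolded valid_cuts_def, THEN conjunct1, THEN mp]
lemmas cut12 = cuts[unfolded valid_cuts_def, THEN conjunct2, THEN conjunct1]
lemmas cut_skip1 = cuts[unfolded valid_cuts_def, THEN conjunct2, THEN conjunct2, THEN conjunct1, THEN mp]
lemmas cut1 = cuts[unfolded valid_cuts_def, THEN conjunct2, THEN conjunct2, THEN conjunct2,
    THEN conjunct2, THEN conjunct1, THEN mp]
lemmas cut2 = cuts[unfolded valid_cuts_def, THEN conjunct2, THEN conjunct2, THEN conjunct2,
    THEN conjunct2, THEN conjunct2, THEN conjunct1, THEN mp]
lemmas cut3 = cuts[unfolded valid_cuts_def, THEN conjunct2, THEN conjunct2, THEN conjunct2,
    THEN conjunct2, THEN conjunct2, THEN conjunct2, THEN mp]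

lemma swap: "cut_system S2 S1 d0 d2 d1 d3 z F v"
  by unfold_locales
    (use ne d F_Un F_le F_le_sum z_le sum_ge valid_cuts_swap[OF cuts] in \<open>auto simp: Int_commute\<close>)

abbreviation psum :: "int \<Rightarrow> int \<Rightarrow> int \<Rightarrow> int \<Rightarrow> int \<Rightarrow> real" where
  "psum \<equiv> pattern_sum d0 d1 d2 d3"

text \<open>The five weights are nonnegative by (A). Hence a bound on \<open>F Q\<close> may be
  weakened entry by entry, which reduces the case analyses below to integer comparisons.\<close>

lemma pattern_sum_mono:
  assumes "x \<le> psum b0 b1 b2 b3 b4"
    and "b0 \<le> c0" "b1 \<le> c1" "b2 \<le> c2" "b3 \<le> c3" "b4 \<le> c4"
  shows "x \<le> psum c0 c1 c2 c3 c4"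
proof -
  have "psum b0 b1 b2 b3 b4 \<le> psum c0 c1 c2 c3 c4"
    unfolding pattern_sum_def using assms(2-6) d
    by (intro add_mono mult_left_mono) auto
  then show ?thesis using assms(1) by linarith
qed

text \<open>Bound \<open>z\<close> on the four pieces of \<open>Q\<close> by the inequalities
  \<open>z j + \<delta> i \<le> 1\<close> and \<open>z j \<le> 1\<close> of (B). Each resulting
  bound is the total weight of the patterns in which a point of that piece is allowed; regrouping by
  pattern gives the sum.\<close>

lemma F_le_card:
  "F Q \<le> psum (icard Q) (icard (Q - S1 \<inter> S2)) (icard (Q - S1)) (icard (Q - S2))
     (icard (Q - (S1 \<union> S2)))"
proof -
  have bd: "sum z R \<le> of_int (icard R) * b" if "\<And>j. j \<in> R \<Longrightarrow> z j \<le> b" for R b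
    using sum_bounded_above[of R z b] that by simp
  have split: "sum z A = sum z B + sum z C" if "A = B \<union> C" "B \<inter> C = {}" for A B C
    using that by (simp add: sum.union_disjoint)
  have "sum z Q = sum z (Q \<inter> S1 \<inter> S2) + sum z (Q - S1 \<inter> S2)" by (rule split) blast+
  moreover have "sum z (Q - S1 \<inter> S2) = sum z (Q \<inter> S2 - S1) + sum z (Q - S2)"
    by (rule split) blast+
  moreover have "sum z (Q - S2) = sum z (Q \<inter> S1 - S2) + sum z (Q - (S1 \<union> S2))"
    by (rule split) blast+
  moreover have "sum z (Q \<inter> S1 \<inter> S2) \<le> of_int (icard (Q \<inter> S1 \<inter> S2)) * (1 - d0)"
    using z_le by (intro bd) auto
  moreover have "sum z (Q \<inter> S1 - S2) \<le> of_int (icard (Q \<inter> S1 - S2)) * (1 - d1)"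
    using z_le by (intro bd) auto
  moreover have "sum z (Q \<inter> S2 - S1) \<le> of_int (icard (Q \<inter> S2 - S1)) * (1 - d2)"
    using z_le by (intro bd) auto
  moreover have "sum z (Q - (S1 \<union> S2)) \<le> of_int (icard (Q - (S1 \<union> S2))) * 1"
    using z_le by (intro bd) auto
  ultimately show ?thesis
    using F_le_sum[of Q] unfolding icard_split[where Q = Q and ?S1.0 = S1 and ?S2.0 = S2]
    by (simp add: pattern_sum_def algebra_simps)
qed

lemma F_Un_ge:
  assumes "Q \<inter> T = {}" "c \<le> sum z T"
  shows "F Q \<le> F (Q \<union> T) - c"
  using F_Un[OF assms(1)] assms(2) by simp

context
  fixes Q :: "'a set" and q r0 r1 r2 r3 :: int
  defines "q \<equiv> icard Q" and "r0 \<equiv> icard (Q - S1 \<inter> S2)" and "r1 \<equiv> icard (Q - S1)"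
    and "r2 \<equiv> icard (Q - S2)" and "r3 \<equiv> icard (Q - (S1 \<union> S2))"
begin

lemma sizes:
  "icard (Q \<inter> S1 - S2) = r2 - r3" "icard (Q \<inter> S2 - S1) = r1 - r3" "r0 = r1 + r2 - r3"
  "icard (Q \<inter> S1 \<inter> S2) = q - r0" "r3 \<le> r1" "r3 \<le> r2" "r0 \<le> q"
  using icard_split[where Q = Q and ?S1.0 = S1 and ?S2.0 = S2]
  unfolding q_def r0_def r1_def r2_def r3_def by linarith+

lemma F_le_sizes: "F Q \<le> psum q r0 r1 r2 r3"
  using F_le_card unfolding q_def r0_def r1_def r2_def r3_def .

text \<open>This bound and the next five share one shape: every pattern is capped either by the
  capacity \<open>v\<close> or by the number of points of \<open>Q\<close> available to it, and the
  cuts differ in where they put \<open>v\<close>. Here it is \<open>v\<close> throughout, since the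
  weights add up to 1.\<close>

lemma F_le_v: "F Q \<le> psum v v v v v"
  using F_le[of Q] by (simp add: pattern_sum_def algebra_simps)

lemma F_le_cut0: "r0 \<le> v \<Longrightarrow> F Q \<le> psum v r0 r1 r2 r3"
  using cut0[of Q] unfolding sizes(1,2) r0_def[symmetric] unfolding sizes(3)
  by (simp add: pattern_sum_def algebra_simps)

lemma F_le_cut12: "F Q \<le> psum v v r1 r2 r3"
  using cut12[of Q] unfolding r0_def[symmetric] r1_def[symmetric] r2_def[symmetric] sizes(3)
  by (simp add: pattern_sum_def algebra_simps)

lemma F_le_cut1: "r1 \<le> v \<Longrightarrow> F Q \<le> psum v v r1 v r3"
  using cut1[of Q] unfolding r1_def[symmetric] sizes(2)
  by (simp add: pattern_sum_def algebra_simps)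

lemma F_le_cut2: "r2 \<le> v \<Longrightarrow> F Q \<le> psum v v v r2 r3"
  using cut2[of Q] unfolding r2_def[symmetric] sizes(1)
  by (simp add: pattern_sum_def algebra_simps)

lemma F_le_cut3: "r3 \<le> v \<Longrightarrow> F Q \<le> psum v v v v r3"
  using cut3[of Q] unfolding r3_def[symmetric]
  by (simp add: pattern_sum_def algebra_simps)

text \<open>Since \<open>r3\<close> is at most \<open>r1\<close> and \<open>r2\<close>, which are at
  most \<open>r0 \<le> q\<close>, only seven positions of \<open>v\<close> among the sizes occur. In
  each, one of the bounds above already has the required minimum in every entry.\<close>

lemma F_le_pattern_sum_hit:
  "F Q \<le> psum (min q v) (min r0 v) (min r1 v) (min r2 v) (min r3 v)"
proof -
  consider "q \<le> v" | "v \<le> q" "r0 \<le> v" | "v \<le> r0" "r1 \<le> v" "r2 \<le> v"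
    | "r1 \<le> v" "v \<le> r2" | "r2 \<le> v" "v \<le> r1" | "v \<le> r1" "v \<le> r2" "r3 \<le> v" | "v \<le> r3"
    by linarith
  then show ?thesis
  proof cases
    case 1
    show ?thesis by (rule pattern_sum_mono[OF F_le_sizes]; (intro min.boundedI)?; use 1 sizes(3,5-7) in linarith)
  next
    case 2
    show ?thesis by (rule pattern_sum_mono[OF F_le_cut0]; (intro min.boundedI)?; use 2 sizes(3,5-7) in linarith)
  next
    case 3
    show ?thesis by (rule pattern_sum_mono[OF F_le_cut12]; (intro min.boundedI)?; use 3 sizes(3,5-7) in linarith)
  next
    case 4
    show ?thesis by (rule pattern_sum_mono[OF F_le_cut1]; (intro min.boundedI)?; use 4 sizes(3,5-7) in linarith)
  next
    case 5
    show ?thesis by (rule pattern_sum_mono[OF F_le_cut2]; (intro min.boundedI)?; use 5 sizes(3,5-7) in linarith)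
  next
    case 6
    show ?thesis by (rule pattern_sum_mono[OF F_le_cut3]; (intro min.boundedI)?; use 6 sizes(3,5-7) in linarith)
  next
    case 7
    show ?thesis by (rule pattern_sum_mono[OF F_le_v]; (intro min.boundedI)?; use 7 sizes(3,5-7) in linarith)
  qed
qed

text \<open>With \<open>S1 - S2\<close> missed, patterns (1,0,0,0) and (1,0,1,0) must spend one
  point outside \<open>Q\<close>, so their capacity drops to \<open>v - 1\<close>. Two further
  bounds supply this loss: the third cut, and \<open>F_le\<close> for
  \<open>Q \<union> (S1 - S2)\<close>.\<close>

lemma F_le_pattern_sum_skip1:
  assumes "Q \<inter> (S1 \<inter> S2) \<noteq> {}" "Q \<inter> (S1 - S2) = {}" "Q \<inter> (S2 - S1) \<noteq> {}"
  shows "F Q \<le> psum (min q v) (min r0 (v - 1)) (min r1 v) (min r2 (v - 1)) (min r3 v)"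
proof -
  have "icard (Q \<inter> S1 - S2) = 0" using assms(2) by (simp add: Int_Diff)
  then have r: "r2 = r3" "r0 = r1" using sizes by linarith+
  have "0 < icard (Q \<inter> S2 - S1)" using assms(3) by (simp add: Int_Diff card_gt_0_iff)
  then have r31: "r3 < r1" using sizes by linarith
  have skip: "F Q \<le> psum v (v - 1) v r2 r2"
    using cut_skip1[OF assms(2)] unfolding r2_def[symmetric]
    by (simp add: pattern_sum_def algebra_simps)
  have v: "F Q \<le> psum v (v - 1) v (v - 1) v"
    using F_Un_ge[OF assms(2) sum_ge(2)] F_le[of "Q \<union> (S1 - S2)"]
    by (simp add: pattern_sum_def algebra_simps)
  consider "q \<le> v" "r0 \<le> v - 1" | "v \<le> q" "r0 \<le> v - 1" | "v \<le> r0" "r2 \<le> v - 1" | "v \<le> r2" by linarith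
  then show ?thesis
  proof cases
    case 1
    show ?thesis by (rule pattern_sum_mono[OF F_le_sizes]; (intro min.boundedI)?; use 1 sizes(3,5-7) r31 r in linarith)
  next
    case 2
    show ?thesis by (rule pattern_sum_mono[OF F_le_cut0]; (intro min.boundedI)?; use 2 sizes(3,5-7) r31 r in linarith)
  next
    case 3
    show ?thesis by (rule pattern_sum_mono[OF skip]; (intro min.boundedI)?; use 3 sizes(3,5-7) r31 r in linarith)
  next
    case 4
    show ?thesis by (rule pattern_sum_mono[OF v]; (intro min.boundedI)?; use 4 sizes(3,5-7) r31 r in linarith)
  qed
qed

lemma F_le_disjoint:
  assumes "Q \<inter> (S1 - S2) = {}" "Q \<inter> (S2 - S1) = {}"
  shows "F Q \<le> F (Q \<union> (S1 - S2) \<union> (S2 - S1)) - (d0 - d1) - (d0 - d2)"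
proof -
  have "(Q \<union> (S1 - S2)) \<inter> (S2 - S1) = {}" using assms by blast
  from F_Un_ge[OF this sum_ge(3)] F_Un_ge[OF assms(1) sum_ge(2)] show ?thesis by linarith
qed

text \<open>Both differences are missed, so pattern (1,0,0,0) loses two points and its two
  neighbours one each. The losses come from adding both differences to \<open>Q\<close>, each of
  which raises \<open>F\<close> by at least its bound in (B).\<close>

lemma F_le_pattern_sum_skip12:
  assumes "Q \<inter> (S1 \<inter> S2) \<noteq> {}" "Q \<inter> (S1 - S2) = {}" "Q \<inter> (S2 - S1) = {}"
  shows "F Q \<le> psum (min q v) (min r0 (v - 2)) (min r1 (v - 1)) (min r2 (v - 1)) (min r3 v)"
proof -
  have "icard (Q \<inter> S1 - S2) = 0" "icard (Q \<inter> S2 - S1) = 0" using assms by (simp_all add: Int_Diff)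
  moreover have "0 < icard (Q \<inter> S1 \<inter> S2)" using assms(1) by (simp add: Int_assoc card_gt_0_iff)
  ultimately have r: "r1 = r3" "r2 = r3" "r0 = r3" "r3 < q" using sizes by linarith+
  define Q' where "Q' = Q \<union> (S1 - S2) \<union> (S2 - S1)"
  have "Q' - (S1 \<union> S2) = Q - (S1 \<union> S2)" unfolding Q'_def by blast
  then have Q': "F Q' + of_int (v - r3) * d3 \<le> of_int v" if "r3 \<le> v"
    using cut3[of Q'] that unfolding r3_def by simp
  have FQ: "F Q \<le> F Q' - (d0 - d1) - (d0 - d2)"
    using F_le_disjoint[OF assms(2,3)] unfolding Q'_def .
  \<comment> \<open>At \<open>r3 = v - 1\<close> the entry of the first pattern with a loss is
    already below \<open>r0\<close>, while the last entry is still below \<open>v\<close>; only the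
    last cut for \<open>Q'\<close> captures both.\<close>
  have skip: "F Q \<le> psum v (v - 2) (v - 1) (v - 1) (v - 1)" if "r3 = v - 1"
    using Q' FQ that by (simp add: pattern_sum_def algebra_simps)
  have v: "F Q \<le> psum v (v - 2) (v - 1) (v - 1) v"
    using FQ F_le[of Q'] by (simp add: pattern_sum_def algebra_simps)
  consider "q \<le> v" "r3 \<le> v - 2" | "v \<le> q" "r3 \<le> v - 2" | "r3 = v - 1" | "v \<le> r3" by linarith
  then show ?thesis
  proof cases
    case 1
    show ?thesis by (rule pattern_sum_mono[OF F_le_sizes]; (intro min.boundedI)?; use 1 r in linarith)
  next
    case 2
    show ?thesis by (rule pattern_sum_mono[OF F_le_cut0]; (intro min.boundedI)?; use 2 r in linarith)
  next
    case 3
    show ?thesis by (rule pattern_sum_mono[OF skip]; (intro min.boundedI)?; use 3 r in linarith)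
  next
    case 4
    show ?thesis by (rule pattern_sum_mono[OF v]; (intro min.boundedI)?; use 4 r in linarith)
  qed
qed

end

text \<open>The entries are the trace bounds that \<open>hitting_set_maximizer\<close> guarantees
  for the five patterns.\<close>

definition pattern_bound :: "'a set \<Rightarrow> real" where
  "pattern_bound Q = psum (min (icard Q) (v - missed Q (S1 \<inter> S2)))
     (min (icard (Q - S1 \<inter> S2)) (v - (missed Q (S1 - S2) + missed Q (S2 - S1))))
     (min (icard (Q - S1)) (v - missed Q (S2 - S1)))
     (min (icard (Q - S2)) (v - missed Q (S1 - S2)))
     (min (icard (Q - (S1 \<union> S2))) v)"

lemma F_le_pattern_bound_meet:
  assumes "Q \<inter> (S1 \<inter> S2) \<noteq> {}"
  shows "F Q \<le> pattern_bound Q"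
proof -
  interpret sw: cut_system S2 S1 d0 d2 d1 d3 z F v by (rule swap)
  have sw: "sw.psum b0 b1 b2 b3 b4 = psum b0 b1 b3 b2 b4" for b0 b1 b2 b3 b4
    unfolding pattern_sum_def by (simp add: algebra_simps)
  have sw': "Q \<inter> (S2 \<inter> S1) \<noteq> {}" using assms by blast
  have com: "S2 \<inter> S1 = S1 \<inter> S2" "S2 \<union> S1 = S1 \<union> S2" by blast+
  have m: "missed Q (S1 \<inter> S2) = 0" using assms by (simp add: missed_def)
  consider "Q \<inter> (S1 - S2) = {}" "Q \<inter> (S2 - S1) = {}" | "Q \<inter> (S1 - S2) = {}" "Q \<inter> (S2 - S1) \<noteq> {}"
    | "Q \<inter> (S1 - S2) \<noteq> {}" "Q \<inter> (S2 - S1) = {}" | "Q \<inter> (S1 - S2) \<noteq> {}" "Q \<inter> (S2 - S1) \<noteq> {}" by blast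
  then show ?thesis
  proof cases
    case 1
    then show ?thesis using F_le_pattern_sum_skip12[OF assms 1]
      unfolding pattern_bound_def m by (simp add: missed_def)
  next
    case 2
    then show ?thesis using F_le_pattern_sum_skip1[OF assms 2]
      unfolding pattern_bound_def m by (simp add: missed_def)
  next
    case 3
    then show ?thesis using sw.F_le_pattern_sum_skip1[OF sw' 3(2,1)]
      unfolding pattern_bound_def m sw com by (simp add: missed_def)
  next
    case 4
    then show ?thesis using F_le_pattern_sum_hit[of Q]
      unfolding pattern_bound_def m by (simp add: missed_def)
  qed
qed

text \<open>If \<open>Q\<close> misses \<open>S1 \<inter> S2\<close>, adding that set raises
  \<open>F\<close> by at least \<open>1 - d0\<close>, the weight of the pattern (0,0,0,0), which is
  the one that loses a point. This settles large \<open>Q\<close>; for small \<open>Q\<close> the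
  size bound suffices, apart from one boundary case.\<close>

lemma F_le_pattern_bound: "F Q \<le> pattern_bound Q"
proof (cases "Q \<inter> (S1 \<inter> S2) = {}")
  case False
  then show ?thesis by (rule F_le_pattern_bound_meet)
next
  case disj: True
  note sizes = sizes[of Q]
  have "icard (Q \<inter> S1 \<inter> S2) = 0" using disj by (simp add: Int_assoc)
  then have q: "icard Q = icard (Q - S1 \<inter> S2)" using sizes by linarith
  have m: "missed Q (S1 \<inter> S2) = 1" using disj by (simp add: missed_def)
  have m1: "missed Q (S1 - S2) = 0 \<and> 0 < icard (Q \<inter> S1 - S2)
      \<or> missed Q (S1 - S2) = 1 \<and> icard (Q \<inter> S1 - S2) = 0"
    unfolding missed_def by (auto simp: Int_Diff card_gt_0_iff)
  have m2: "missed Q (S2 - S1) = 0 \<and> 0 < icard (Q \<inter> S2 - S1)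
      \<or> missed Q (S2 - S1) = 1 \<and> icard (Q \<inter> S2 - S1) = 0"
    unfolding missed_def by (auto simp: Int_Diff card_gt_0_iff)
  consider "v \<le> icard Q"
    | "icard Q = v - 1" "missed Q (S1 - S2) = 1" "missed Q (S2 - S1) = 1"
    | "icard Q \<le> v - 1" "icard Q \<le> v - (missed Q (S1 - S2) + missed Q (S2 - S1))"
    using m1 m2 by linarith
  then show ?thesis
  proof cases
    case 1
    define Q' where "Q' = Q \<union> S1 \<inter> S2"
    have eq: "Q' - S1 \<inter> S2 = Q - S1 \<inter> S2" "Q' - S1 = Q - S1" "Q' - S2 = Q - S2"
      "Q' - (S1 \<union> S2) = Q - (S1 \<union> S2)" "Q' \<inter> (S1 - S2) = Q \<inter> (S1 - S2)"
      "Q' \<inter> (S2 - S1) = Q \<inter> (S2 - S1)"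
      unfolding Q'_def by blast+
    have eq': "missed Q' (S1 - S2) = missed Q (S1 - S2)" "missed Q' (S2 - S1) = missed Q (S2 - S1)"
      unfolding missed_def eq by (rule refl)+
    have ne': "Q' \<inter> (S1 \<inter> S2) \<noteq> {}" unfolding Q'_def using ne by auto
    then have m': "missed Q' (S1 \<inter> S2) = 0" by (simp add: missed_def)
    have "icard Q \<le> icard Q'" unfolding Q'_def by (simp add: card_mono)
    then have mins: "min (icard Q') v = v" "min (icard Q) (v - 1) = v - 1" using 1 by linarith+
    have "F Q' \<le> pattern_bound Q + (1 - d0)"
      using F_le_pattern_bound_meet[OF ne']
      unfolding pattern_bound_def eq eq' m m' diff_zero mins by (simp add: pattern_sum_def algebra_simps)
    then show ?thesis using F_Un_ge[OF disj sum_ge(1)] unfolding Q'_def by linarith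
  next
    \<comment> \<open>Boundary case: pattern (1,0,0,0) has capacity \<open>v - 2\<close>, one less
      than the size of \<open>Q\<close>. Adding all three missed pieces and using the last cut
      recovers this unit.\<close>
    case 2
    then have e: "Q \<inter> (S1 - S2) = {}" "Q \<inter> (S2 - S1) = {}" by (auto simp: missed_def)
    have r: "icard (Q - S1 \<inter> S2) = v - 1" "icard (Q - S1) = v - 1" "icard (Q - S2) = v - 1"
      "icard (Q - (S1 \<union> S2)) = v - 1" using 2 m1 m2 sizes q by linarith+
    define Q' where "Q' = Q \<union> (S1 - S2) \<union> (S2 - S1)"
    have Q': "Q' \<inter> (S1 \<inter> S2) = {}" using disj unfolding Q'_def by blast
    have "(Q' \<union> S1 \<inter> S2) - (S1 \<union> S2) = Q - (S1 \<union> S2)" unfolding Q'_def by blast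
    then have "F (Q' \<union> S1 \<inter> S2) + d3 \<le> of_int v"
      using cut3[of "Q' \<union> S1 \<inter> S2"] r(4) by simp
    moreover have "F Q \<le> F Q' - (d0 - d1) - (d0 - d2)"
      using F_le_disjoint[OF e] unfolding Q'_def .
    moreover have "F Q' \<le> F (Q' \<union> S1 \<inter> S2) - (1 - d0)"
      using F_Un_ge[OF Q' sum_ge(1)] .
    ultimately show ?thesis
      unfolding pattern_bound_def m 2 r by (simp add: pattern_sum_def algebra_simps)
  next
    case 3
    show ?thesis unfolding pattern_bound_def m
      by (rule pattern_sum_mono[OF F_le_sizes]; (intro min.boundedI)?; use 3 m1 m2 sizes q in linarith)
  qed
qed

end

section \<open>The integer points satisfy the inequalities\<close>

lemma all_4: "(\<forall>i::4. P i) \<longleftrightarrow> P 0 \<and> P 1 \<and> P 2 \<and> P 3"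
proof -
  have "(4::4) = 0" by simp
  then have "P 4 \<longleftrightarrow> P 0" by (rule arg_cong)
  then show ?thesis unfolding forall_4 by blast
qed

lemma S_fam_simps [simp]:
  "S_fam S1 S2 0 = S1 \<inter> S2" "S_fam S1 S2 1 = S1" "S_fam S1 S2 2 = S2" "S_fam S1 S2 3 = S1 \<union> S2"
  by (simp_all add: S_fam_def)

definition incidence :: "'a::finite set \<Rightarrow> 'a set \<Rightarrow> 'a set \<Rightarrow> (real ^ 4) \<times> (real ^ 'a)" where
  "incidence S1 S2 A = (\<chi> i. of_bool (A \<inter> S_fam S1 S2 i = {}), \<chi> j. of_bool (j \<in> A))"

lemma X_bar_eq: "X_bar l u S1 S2 = incidence S1 S2 ` {A. l \<le> icard A \<and> icard A \<le> u}"
proof -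
  have prod: "(\<Prod>j\<in>S. 1 - of_bool (j \<in> A)) = (of_bool (A \<inter> S = {}) :: real)" for A S :: "'a set"
  proof (cases "A \<inter> S = {}")
    case True
    then show ?thesis by (auto intro!: prod.neutral)
  next
    case False
    then show ?thesis by (auto intro!: prod_zero)
  qed
  have sum: "(\<Sum>j\<in>UNIV. of_bool (j \<in> A)) = real (card A)" for A :: "'a set"
    by simp
  have "p \<in> X_bar l u S1 S2" if A: "l \<le> icard A" "icard A \<le> u" and p: "p = incidence S1 S2 A" for p A
    using A unfolding p incidence_def X_bar_def by (simp add: prod sum)
  moreover have "p \<in> incidence S1 S2 ` {A. l \<le> icard A \<and> icard A \<le> u}" if p: "p \<in> X_bar l u S1 S2" for p
  proof -
    obtain \<delta> z where dz: "p = (\<delta>, z)" by (cases p)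
    define A where "A = {j. z $ j = 1}"
    have z: "z $ j = of_bool (j \<in> A)" for j
      using p unfolding dz X_bar_def A_def by auto
    have "\<delta> $ i = of_bool (A \<inter> S_fam S1 S2 i = {})" for i
      using p unfolding dz X_bar_def by (simp add: z prod)
    then have "p = incidence S1 S2 A"
      unfolding dz incidence_def by (simp add: vec_eq_iff z)
    moreover have "real_of_int l \<le> real (card A)" "real (card A) \<le> real_of_int u"
      using p unfolding dz X_bar_def by (simp_all add: z sum)
    then have "l \<le> icard A" "icard A \<le> u" by linarith+
    ultimately show ?thesis by blast
  qed
  ultimately show ?thesis by blast
qed

section \<open>(C) and (D) as valid cuts, and their validity at integer points\<close>

lemma ineqs_C_iff:
  "ineqs_C u (S_fam S1 S2) \<delta> z Q \<longleftrightarrow>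
     valid_cuts S1 S2 u Q (\<delta> $ 0) (\<delta> $ 1) (\<delta> $ 2) (\<delta> $ 3) (\<Sum>j\<in>Q. z $ j)"
proof -
  have ik: "(\<forall>i k. {i, k} = {1, 2} \<and> P i \<longrightarrow> R i k) \<longleftrightarrow> (P 1 \<longrightarrow> R 1 2) \<and> (P 2 \<longrightarrow> R 2 1)"
    for P and R :: "4 \<Rightarrow> 4 \<Rightarrow> bool" by (auto simp: doubleton_eq_iff)
  have eq: "S1 - S1 \<inter> S2 = S1 - S2" "S2 - S1 \<inter> S2 = S2 - S1" "Q \<inter> S1 - S1 \<inter> S2 = Q \<inter> S1 - S2"
    "Q \<inter> S2 - S1 \<inter> S2 = Q \<inter> S2 - S1" "Q \<inter> (S1 \<union> S2) - S1 = Q \<inter> S2 - S1"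
    "Q \<inter> (S1 \<union> S2) - S2 = Q \<inter> S1 - S2" by blast+
  show ?thesis
    unfolding ineqs_C_def valid_cuts_def ik by (simp add: eq add.assoc)
qed

text \<open>Complementation turns \<open>Q \<union> S\<close> into \<open>- Q - S\<close>, whose
  size is \<open>n\<close> minus that of the union; adding \<open>l\<close> on both sides then gives
  the cut for \<open>- Q\<close>.\<close>

lemma ineqs_D_iff:
  "ineqs_D l (S_fam S1 S2) \<delta> z Q \<longleftrightarrow>
     valid_cuts S1 S2 l (- Q) (\<delta> $ 0) (\<delta> $ 1) (\<delta> $ 2) (\<delta> $ 3) (of_int l - (\<Sum>j\<in>Q. z $ j))"
proof -
  have ik: "(\<forall>i k. {i, k} = {1, 2} \<and> P i \<longrightarrow> R i k) \<longleftrightarrow> (P 1 \<longrightarrow> R 1 2) \<and> (P 2 \<longrightarrow> R 2 1)"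
    for P and R :: "4 \<Rightarrow> 4 \<Rightarrow> bool" by (auto simp: doubleton_eq_iff)
  have eq: "S1 - S1 \<inter> S2 = S1 - S2" "S2 - S1 \<inter> S2 = S2 - S1"
    "S1 - (S1 \<inter> S2 \<union> Q) = - Q \<inter> S1 - S2" "S2 - (S1 \<inter> S2 \<union> Q) = - Q \<inter> S2 - S1"
    "S1 \<union> S2 - (S1 \<union> Q) = - Q \<inter> S2 - S1" "S1 \<union> S2 - (S2 \<union> Q) = - Q \<inter> S1 - S2"
    "S1 - S2 \<subseteq> Q \<longleftrightarrow> - Q \<inter> (S1 - S2) = {}" "S2 - S1 \<subseteq> Q \<longleftrightarrow> - Q \<inter> (S2 - S1) = {}" by blast+
  have card: "icard (Q \<union> S) = int CARD('a) - icard (- Q - S)" for S :: "'a set"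
  proof -
    have "- Q - S = UNIV - (Q \<union> S)" by blast
    then have "card (- Q - S) = CARD('a) - card (Q \<union> S)" by (simp add: card_Diff_subset)
    moreover have "card (Q \<union> S) \<le> CARD('a)" by (simp add: card_mono)
    ultimately show ?thesis by linarith
  qed
  show ?thesis
    unfolding ineqs_D_def valid_cuts_def ik Let_def S_fam_simps card eq
    by (simp add: eq algebra_simps)
qed

text \<open>Checked on the five possible patterns of \<open>A\<close>. The value \<open>f\<close>
  stands for \<open>icard (A \<inter> Q)\<close> or \<open>l - icard (A \<inter> Q)\<close>; the
  last two hypotheses supply the unit lost in the cuts with \<open>v - 1\<close> when
  \<open>A\<close> meets a difference that \<open>Q\<close> misses.\<close>

lemma valid_cuts_incidence:
  fixes A Q S1 S2 :: "'a::finite set" and f v :: int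
  assumes "f \<le> v"
    and "A \<inter> (S1 \<inter> S2) = {} \<Longrightarrow> f \<le> icard (Q - S1 \<inter> S2)"
    and "A \<inter> S1 = {} \<Longrightarrow> f \<le> icard (Q - S1)" and "A \<inter> S2 = {} \<Longrightarrow> f \<le> icard (Q - S2)"
    and "A \<inter> (S1 \<union> S2) = {} \<Longrightarrow> f \<le> icard (Q - (S1 \<union> S2))"
    and "Q \<inter> (S1 - S2) = {} \<Longrightarrow> A \<inter> (S1 - S2) \<noteq> {} \<Longrightarrow> f \<le> v - 1"
    and "Q \<inter> (S2 - S1) = {} \<Longrightarrow> A \<inter> (S2 - S1) \<noteq> {} \<Longrightarrow> f \<le> v - 1"
  shows "valid_cuts S1 S2 v Q (of_bool (A \<inter> (S1 \<inter> S2) = {})) (of_bool (A \<inter> S1 = {}))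
    (of_bool (A \<inter> S2 = {})) (of_bool (A \<inter> (S1 \<union> S2) = {})) (of_int f)"
proof -
  define a1 a2 r3 where "a1 = icard (Q \<inter> S1 - S2)" and "a2 = icard (Q \<inter> S2 - S1)"
    and "r3 = icard (Q - (S1 \<union> S2))"
  have r: "icard (Q - S1) = a2 + r3" "icard (Q - S2) = a1 + r3" "icard (Q - S1 \<inter> S2) = a1 + a2 + r3"
    using icard_split[where Q = Q and ?S1.0 = S1 and ?S2.0 = S2] by (simp_all add: a1_def a2_def r3_def)
  have nn: "0 \<le> a1" "0 \<le> a2" "0 \<le> r3" by (simp_all add: a1_def a2_def r3_def)
  have m: "f \<le> v - 1" if "Q \<inter> (S1 - S2) = {}" "A \<inter> (S1 \<inter> S2) = {}" "A \<inter> S1 \<noteq> {}"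
    using assms(6)[OF that(1)] that by blast
  have m': "f \<le> v - 1" if "Q \<inter> (S2 - S1) = {}" "A \<inter> (S1 \<inter> S2) = {}" "A \<inter> S2 \<noteq> {}"
    using assms(7)[OF that(1)] that by blast
  have un: "A \<inter> (S1 \<union> S2) = {} \<longleftrightarrow> A \<inter> S1 = {} \<and> A \<inter> S2 = {}" by blast
  have int: "A \<inter> S1 = {} \<Longrightarrow> A \<inter> (S1 \<inter> S2) = {}" "A \<inter> S2 = {} \<Longrightarrow> A \<inter> (S1 \<inter> S2) = {}" by blast+
  have f0: "real_of_int f \<le> of_int v" using assms(1) by simp
  have f1: "real_of_int f \<le> of_int a1 + of_int a2 + of_int r3" if "A \<inter> (S1 \<inter> S2) = {}"
    using assms(2)[OF that] unfolding r by linarith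
  have f2: "real_of_int f \<le> of_int a2 + of_int r3" if "A \<inter> S1 = {}"
    using assms(3)[OF that] unfolding r by linarith
  have f3: "real_of_int f \<le> of_int a1 + of_int r3" if "A \<inter> S2 = {}"
    using assms(4)[OF that] unfolding r by linarith
  have f4: "real_of_int f \<le> of_int r3" if "A \<inter> S1 = {}" "A \<inter> S2 = {}"
    using assms(5) that unfolding un r3_def by simp
  have m: "real_of_int f + 1 \<le> of_int v"
    if "Q \<inter> (S1 - S2) = {}" "A \<inter> (S1 \<inter> S2) = {}" "A \<inter> S1 \<noteq> {}"
    using m[OF that] by linarith
  have m': "real_of_int f + 1 \<le> of_int v"
    if "Q \<inter> (S2 - S1) = {}" "A \<inter> (S1 \<inter> S2) = {}" "A \<inter> S2 \<noteq> {}"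
    using m'[OF that] by linarith
  consider "A \<inter> (S1 \<inter> S2) \<noteq> {}" "A \<inter> S1 \<noteq> {}" "A \<inter> S2 \<noteq> {}"
    | "A \<inter> (S1 \<inter> S2) = {}" "A \<inter> S1 \<noteq> {}" "A \<inter> S2 \<noteq> {}"
    | "A \<inter> (S1 \<inter> S2) = {}" "A \<inter> S1 = {}" "A \<inter> S2 \<noteq> {}"
    | "A \<inter> (S1 \<inter> S2) = {}" "A \<inter> S1 \<noteq> {}" "A \<inter> S2 = {}"
    | "A \<inter> (S1 \<inter> S2) = {}" "A \<inter> S1 = {}" "A \<inter> S2 = {}" using int by blast
  then show ?thesis
  proof cases
    case 1
    then show ?thesis using f0 nn
      unfolding valid_cuts_def r un a1_def[symmetric] a2_def[symmetric] r3_def[symmetric] by simp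
  next
    case 2
    then show ?thesis using f0 f1 m m' nn
      unfolding valid_cuts_def r un a1_def[symmetric] a2_def[symmetric] r3_def[symmetric] by simp
  next
    case 3
    then show ?thesis using f0 f1 f2 m m' nn
      unfolding valid_cuts_def r un a1_def[symmetric] a2_def[symmetric] r3_def[symmetric] by simp
  next
    case 4
    then show ?thesis using f0 f1 f3 m m' nn
      unfolding valid_cuts_def r un a1_def[symmetric] a2_def[symmetric] r3_def[symmetric] by simp
  next
    case 5
    then show ?thesis using f0 f1 f2 f3 f4 nn
      unfolding valid_cuts_def r un a1_def[symmetric] a2_def[symmetric] r3_def[symmetric] by simp
  qed
qed

section \<open>Convexity of the solution set\<close>

definition affine_fun :: "('b::real_vector \<Rightarrow> real) \<Rightarrow> bool" where
  "affine_fun f \<longleftrightarrow> (\<forall>x y a b. a + b = 1 \<longrightarrow> f (a *\<^sub>R x + b *\<^sub>R y) = a * f x + b * f y)"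

lemma affine_fun_const: "affine_fun (\<lambda>_. c)"
  by (simp add: affine_fun_def flip: distrib_right)

lemma affine_fun_add: "affine_fun f \<Longrightarrow> affine_fun g \<Longrightarrow> affine_fun (\<lambda>x. f x + g x)"
  by (simp add: affine_fun_def algebra_simps)

lemma affine_fun_diff: "affine_fun f \<Longrightarrow> affine_fun g \<Longrightarrow> affine_fun (\<lambda>x. f x - g x)"
  by (simp add: affine_fun_def algebra_simps)

lemma affine_fun_uminus: "affine_fun f \<Longrightarrow> affine_fun (\<lambda>x. - f x)"
  by (simp add: affine_fun_def)

lemma affine_fun_mult: "affine_fun f \<Longrightarrow> affine_fun (\<lambda>x. c * f x)"
  by (simp add: affine_fun_def algebra_simps)

lemma affine_fun_sum: "(\<And>i. i \<in> I \<Longrightarrow> affine_fun (f i)) \<Longrightarrow> affine_fun (\<lambda>x. \<Sum>i\<in>I. f i x)"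
  by (induction I rule: infinite_finite_induct) (simp_all add: affine_fun_const affine_fun_add)

lemma affine_fun_fst_nth: "affine_fun (\<lambda>x. fst x $ i)"
  by (simp add: affine_fun_def)

lemma affine_fun_snd_nth: "affine_fun (\<lambda>x. snd x $ i)"
  by (simp add: affine_fun_def)

lemma convex_Collect_affine_le:
  assumes "affine_fun f" "affine_fun g"
  shows "convex {x. f x \<le> g x}"
  using assms unfolding affine_fun_def convex_def
  by (auto intro!: add_mono mult_left_mono)

lemma convex_Collect_conjI: "convex {x. P x} \<Longrightarrow> convex {x. Q x} \<Longrightarrow> convex {x. P x \<and> Q x}"
  unfolding convex_def by auto

lemma convex_Collect_allI: "(\<And>i. convex {x. P i x}) \<Longrightarrow> convex {x. \<forall>i. P i x}"
  unfolding convex_def by auto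

lemma convex_Collect_ballI: "(\<And>i. i \<in> I \<Longrightarrow> convex {x. P i x}) \<Longrightarrow> convex {x. \<forall>i\<in>I. P i x}"
  unfolding convex_def by auto

lemma convex_Collect_impI: "(c \<Longrightarrow> convex {x. P x}) \<Longrightarrow> convex {x. c \<longrightarrow> P x}"
  unfolding convex_def by auto

text \<open>Every condition compares two affine functions of the pair, and side conditions on
  \<open>Q\<close> do not involve the point, so convexity follows along the syntax of the
  system.\<close>

lemma convex_ineqs:
  "convex {(\<delta>, z). ineqs_A \<delta> \<and> ineqs_B l u S \<delta> z \<and>
     (\<forall>Q. ineqs_C u S \<delta> z Q) \<and> (\<forall>Q. ineqs_D l S \<delta> z Q)}"
  unfolding case_prod_unfold ineqs_A_def ineqs_B_def ineqs_C_def ineqs_D_def Let_def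
  by (intro convex_Collect_conjI convex_Collect_allI convex_Collect_ballI convex_Collect_impI
      convex_Collect_affine_le affine_fun_const affine_fun_add affine_fun_diff affine_fun_uminus
      affine_fun_mult affine_fun_sum affine_fun_fst_nth affine_fun_snd_nth)

lemma sum_of_bool_mem: "(\<Sum>j\<in>Q. of_bool (j \<in> A)) = real (card (A \<inter> Q))" for A Q :: "'a::finite set"
proof -
  have "Q \<inter> A = A \<inter> Q" by blast
  then show ?thesis by simp
qed

lemma incidence_ineqs:
  fixes A S1 S2 :: "'a::finite set"
  assumes A: "l \<le> icard A" "icard A \<le> u"
  shows "incidence S1 S2 A \<in> {(\<delta>, z). ineqs_A \<delta> \<and> ineqs_B l u (S_fam S1 S2) \<delta> z \<and>
       (\<forall>Q. ineqs_C u (S_fam S1 S2) \<delta> z Q) \<and> (\<forall>Q. ineqs_D l (S_fam S1 S2) \<delta> z Q)}"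
proof -
  define \<delta> :: "real ^ 4" where "\<delta> = fst (incidence S1 S2 A)"
  define z :: "real ^ 'a" where "z = snd (incidence S1 S2 A)"
  have delta: "\<delta> $ 0 = of_bool (A \<inter> (S1 \<inter> S2) = {})" "\<delta> $ 1 = of_bool (A \<inter> S1 = {})"
    "\<delta> $ 2 = of_bool (A \<inter> S2 = {})" "\<delta> $ 3 = of_bool (A \<inter> (S1 \<union> S2) = {})"
    by (simp_all add: \<delta>_def incidence_def)
  have z: "z $ j = of_bool (j \<in> A)" for j by (simp add: z_def incidence_def)
  have sz: "(\<Sum>j\<in>Q. z $ j) = of_int (icard (A \<inter> Q))" for Q
    by (simp only: z sum_of_bool_mem of_int_of_nat_eq)
  have pos: "1 \<le> real (card (A \<inter> T))" if "A \<inter> T \<noteq> {}" for T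
    using that by (simp add: Suc_le_eq card_gt_0_iff)
  have "ineqs_A \<delta>"
    unfolding ineqs_A_def by (auto simp: delta of_bool_def)
  moreover have "ineqs_B l u (S_fam S1 S2) \<delta> z"
  proof -
    have "of_bool (A \<inter> (S1 \<inter> S2) = {}) + real (card (A \<inter> (S1 \<inter> S2))) \<ge> 1"
      using pos[of "S1 \<inter> S2"] by (cases "A \<inter> (S1 \<inter> S2) = {}") simp_all
    moreover have "of_bool (A \<inter> (S1 \<inter> S2) = {}) \<le> of_bool (A \<inter> S1 = {}) + real (card (A \<inter> (S1 - S1 \<inter> S2)))"
    proof (cases "A \<inter> (S1 \<inter> S2) = {} \<and> A \<inter> S1 \<noteq> {}")
      case True
      then have "A \<inter> (S1 - S1 \<inter> S2) \<noteq> {}" by blast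
      then show ?thesis using pos[of "S1 - S1 \<inter> S2"] True by simp
    qed auto
    moreover have "of_bool (A \<inter> (S1 \<inter> S2) = {}) \<le> of_bool (A \<inter> S2 = {}) + real (card (A \<inter> (S2 - S1 \<inter> S2)))"
    proof (cases "A \<inter> (S1 \<inter> S2) = {} \<and> A \<inter> S2 \<noteq> {}")
      case True
      then have "A \<inter> (S2 - S1 \<inter> S2) \<noteq> {}" by blast
      then show ?thesis using pos[of "S2 - S1 \<inter> S2"] True by simp
    qed auto
    moreover have "z $ j + of_bool (A \<inter> S = {}) \<le> 1" if "j \<in> S" for j S
      using that by (auto simp: z of_bool_def)
    ultimately show ?thesis
      unfolding ineqs_B_def sz using A by (simp add: delta) (simp add: z)
  qed
  moreover have "ineqs_C u (S_fam S1 S2) \<delta> z Q" for Q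
  proof -
    have le: "icard (A \<inter> Q) \<le> icard (Q - S)" if "A \<inter> S = {}" for S
      using that by (intro of_nat_mono card_mono) auto
    have le': "icard (A \<inter> Q) \<le> u - 1" if "Q \<inter> T = {}" "A \<inter> T \<noteq> {}" for T
    proof -
      have "A \<inter> Q \<subset> A" using that by blast
      then have "card (A \<inter> Q) < card A" by (simp add: psubset_card_mono)
      then show ?thesis using A by linarith
    qed
    have "icard (A \<inter> Q) \<le> icard A" by (simp add: card_mono)
    then have "icard (A \<inter> Q) \<le> u" using A by linarith
    then show ?thesis unfolding ineqs_C_iff delta sz by (intro valid_cuts_incidence le le')
  qed
  moreover have "ineqs_D l (S_fam S1 S2) \<delta> z Q" for Q
  proof -
    have le: "l - icard (A \<inter> Q) \<le> icard (- Q - S)" if "A \<inter> S = {}" for S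
    proof -
      have "icard A = icard (A \<inter> Q) + icard (A - Q)" by (metis card_Int_Diff finite of_nat_add)
      moreover have "icard (A - Q) \<le> icard (- Q - S)"
        using that by (intro of_nat_mono card_mono) auto
      ultimately show ?thesis using A by linarith
    qed
    \<comment> \<open>Here \<open>T\<close> lies inside \<open>Q\<close>, so a hit of
      \<open>T\<close> is a point of \<open>A \<inter> Q\<close>.\<close>
    have le': "l - icard (A \<inter> Q) \<le> l - 1" if "- Q \<inter> T = {}" "A \<inter> T \<noteq> {}" for T
    proof -
      have "A \<inter> Q \<noteq> {}" using that by blast
      then show ?thesis using pos[of Q] by linarith
    qed
    have "valid_cuts S1 S2 l (- Q) (\<delta> $ 0) (\<delta> $ 1) (\<delta> $ 2) (\<delta> $ 3) (of_int (l - icard (A \<inter> Q)))"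
      unfolding delta by (rule valid_cuts_incidence) (use le le' in auto)
    then show ?thesis unfolding ineqs_D_iff sz by simp
  qed
  moreover have "incidence S1 S2 A = (\<delta>, z)" by (simp add: \<delta>_def z_def)
  ultimately show ?thesis unfolding mem_Collect_eq case_prod_unfold by auto
qed

section \<open>The inequalities describe the hull\<close>

lemma incidence_hitting_sets:
  assumes "A \<in> hitting_sets l u Z \<T>"
  shows "incidence S1 S2 A \<in> X_bar l u S1 S2"
  using assms unfolding hitting_sets_def X_bar_eq by auto

text \<open>These are the five systems in the order of the weights in \<open>pattern_sum\<close>:
  nothing avoided, then \<open>S1 \<inter> S2\<close>, \<open>S1\<close>, \<open>S2\<close>, and
  finally \<open>S1 \<union> S2\<close> avoided.\<close>

lemma fst_incidence:
  assumes "S1 \<inter> S2 \<noteq> {}"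
  shows "A \<in> hitting_sets l u {} {S1 \<inter> S2} \<Longrightarrow> fst (incidence S1 S2 A) = 0"
    "A \<in> hitting_sets l u (S1 \<inter> S2) {S1 - S2, S2 - S1} \<Longrightarrow>
      fst (incidence S1 S2 A) = (\<chi> i. of_bool (i = 0))"
    "A \<in> hitting_sets l u S1 {S2 - S1} \<Longrightarrow>
      fst (incidence S1 S2 A) = (\<chi> i. of_bool (i = 0 \<or> i = 1))"
    "A \<in> hitting_sets l u S2 {S1 - S2} \<Longrightarrow>
      fst (incidence S1 S2 A) = (\<chi> i. of_bool (i = 0 \<or> i = 2))"
    "A \<in> hitting_sets l u (S1 \<union> S2) {} \<Longrightarrow> fst (incidence S1 S2 A) = (\<chi> i. 1)"
  unfolding hitting_sets_def incidence_def vec_eq_iff all_4 by auto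

lemma icard_missed:
  "icard {T \<in> {}. R \<inter> T = {}} = 0"
  "icard {T \<in> {T1}. R \<inter> T = {}} = missed R T1"
  "T1 \<noteq> T2 \<Longrightarrow> icard {T \<in> {T1, T2}. R \<inter> T = {}} = missed R T1 + missed R T2"
proof -
  have [simp]: "{T. T = T1 \<and> R \<inter> T = {}} = (if R \<inter> T1 = {} then {T1} else {})" by auto
  show "icard {T \<in> {}. R \<inter> T = {}} = 0" "icard {T \<in> {T1}. R \<inter> T = {}} = missed R T1"
    by (simp_all add: missed_def)
  assume "T1 \<noteq> T2"
  moreover have "{T \<in> {T1, T2}. R \<inter> T = {}}
    = (if R \<inter> T1 = {} then {T1} else {}) \<union> (if R \<inter> T2 = {} then {T2} else {})" by auto
  ultimately show "icard {T \<in> {T1, T2}. R \<inter> T = {}} = missed R T1 + missed R T2"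
    by (simp add: missed_def)
qed

lemma ineqs_imp_hull:
  fixes S1 S2 :: "'a::finite set"
  assumes lu: "l \<ge> 0" "u \<ge> 2" "u \<ge> l + 1"
    and diff: "S1 - S2 \<noteq> {}" "S2 - S1 \<noteq> {}" and meet: "S1 \<inter> S2 \<noteq> {}"
    and Un: "icard (S1 \<union> S2) \<le> int CARD('a) - l"
    and A: "ineqs_A \<delta>" and B: "ineqs_B l u (S_fam S1 S2) \<delta> z"
    and C: "\<And>Q. ineqs_C u (S_fam S1 S2) \<delta> z Q" and D: "\<And>Q. ineqs_D l (S_fam S1 S2) \<delta> z Q"
  shows "(\<delta>, z) \<in> convex hull (X_bar l u S1 S2)"
proof (rule ccontr)
  assume notin: "(\<delta>, z) \<notin> convex hull (X_bar l u S1 S2)"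
  define d0 d1 d2 d3 where d_def: "d0 = \<delta> $ 0" "d1 = \<delta> $ 1" "d2 = \<delta> $ 2" "d3 = \<delta> $ 3"
  have d: "d0 \<le> 1" "0 \<le> d3" "d3 \<le> d1" "d3 \<le> d2" "d1 + d2 \<le> d0 + d3"
    using A unfolding ineqs_A_def d_def by auto
  have z: "\<And>j. 0 \<le> z $ j" "(\<Sum>j\<in>UNIV. z $ j) \<le> of_int u" "of_int l \<le> (\<Sum>j\<in>UNIV. z $ j)"
    using B unfolding ineqs_B_def by auto
  have z_le: "\<And>j. z $ j \<le> 1" "\<And>j. j \<in> S1 \<inter> S2 \<Longrightarrow> z $ j \<le> 1 - d0"
    "\<And>j. j \<in> S1 \<Longrightarrow> z $ j \<le> 1 - d1" "\<And>j. j \<in> S2 \<Longrightarrow> z $ j \<le> 1 - d2"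
    using B unfolding ineqs_B_def d_def by (simp_all add: le_diff_eq)
  have "S1 - S1 \<inter> S2 = S1 - S2" "S2 - S1 \<inter> S2 = S2 - S1" by blast+
  then have sum_ge: "1 - d0 \<le> sum (($) z) (S1 \<inter> S2)" "d0 - d1 \<le> sum (($) z) (S1 - S2)"
    "d0 - d2 \<le> sum (($) z) (S2 - S1)"
    using B unfolding ineqs_B_def d_def by simp_all
  have split: "sum (($) z) UNIV = sum (($) z) R + sum (($) z) (- R)" for R
    by (subst sum.union_disjoint[symmetric]) auto
  have sum_nonneg: "0 \<le> sum (($) z) R" for R using z by (simp add: sum_nonneg)

  interpret U: cut_system S1 S2 d0 d1 d2 d3 "($) z" "sum (($) z)" u
  proof
    show "sum (($) z) R \<le> of_int u" for R using split[of R] sum_nonneg[of "- R"] z(2) by simp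
    show "sum (($) z) (R \<union> T) = sum (($) z) R + sum (($) z) T" if "R \<inter> T = {}" for R T
      using that by (simp add: sum.union_disjoint)
    show "valid_cuts S1 S2 u Q d0 d1 d2 d3 (sum (($) z) Q)" for Q
      using C[of Q] unfolding ineqs_C_iff d_def .
  qed (use meet d z_le sum_ge in simp_all)
  interpret L: cut_system S1 S2 d0 d1 d2 d3 "($) z" "\<lambda>R. of_int l - sum (($) z) (- R)" l
  proof
    show "of_int l - sum (($) z) (- R) \<le> of_int l" for R using sum_nonneg[of "- R"] by simp
    show "of_int l - sum (($) z) (- R) \<le> sum (($) z) R" for R using split[of R] z(3) by simp
    show "of_int l - sum (($) z) (- (R \<union> T)) = of_int l - sum (($) z) (- R) + sum (($) z) T"
      if "R \<inter> T = {}" for R T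
    proof -
      have "- R = - (R \<union> T) \<union> T" "- (R \<union> T) \<inter> T = {}" using that by blast+
      then have "sum (($) z) (- R) = sum (($) z) (- (R \<union> T)) + sum (($) z) T"
        by (metis finite sum.union_disjoint)
      then show ?thesis by simp
    qed
    show "valid_cuts S1 S2 l Q d0 d1 d2 d3 (of_int l - sum (($) z) (- Q))" for Q
      using D[of "- Q"] unfolding ineqs_D_iff d_def by simp
  qed (use meet d z_le sum_ge in simp_all)

  have "finite (X_bar l u S1 S2)" unfolding X_bar_eq by simp
  then have "closed (convex hull (X_bar l u S1 S2))"
    by (simp add: compact_imp_closed finite_imp_compact_convex_hull)
  then obtain a b where ab: "inner a (\<delta>, z) < b" "\<And>x. x \<in> convex hull (X_bar l u S1 S2) \<Longrightarrow> b < inner a x"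
    using separating_hyperplane_closed_point[OF convex_convex_hull _ notin] by blast
  \<comment> \<open>The hull lies on the larger side of the hyperplane, so small values of the
    functional are wanted; the sign makes this a maximisation of \<open>c\<close>.\<close>
  define c where "c j = - snd a $ j" for j

  have comp: "icard (- S) = int CARD('a) - icard S" for S :: "'a set"
    by (simp add: Compl_eq_Diff_UNIV card_Diff_subset card_mono of_nat_diff)
  \<comment> \<open>The hypothesis on the union leaves room for \<open>l\<close> points in every
    pattern, since each avoided set lies in \<open>S1 \<union> S2\<close>.\<close>
  have le_Un: "l \<le> icard (- (S1 \<union> S2))" using Un comp[of "S1 \<union> S2"] by linarith
  have lS: "l \<le> icard (- S)" if "S \<subseteq> S1 \<union> S2" for S
    using le_Un that by (meson Compl_anti_mono card_mono finite of_nat_mono order_trans)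
  have ne12: "S1 - S2 \<noteq> S2 - S1" using diff by blast
  have fam0: "disjoint {S1 \<inter> S2}" "{} \<notin> {S1 \<inter> S2}" "\<And>T. T \<in> {S1 \<inter> S2} \<Longrightarrow> T \<inter> {} = {}"
    "l \<le> u" "icard {S1 \<inter> S2} \<le> u" "l \<le> icard (- {} :: 'a set)"
    "\<And>R. icard {T \<in> {S1 \<inter> S2}. R \<inter> T = {}} = missed R (S1 \<inter> S2)"
    using meet diff ne12 lu lS[of "{}"] icard_missed(2) by (auto simp: disjoint_def)
  obtain A0 where A0: "A0 \<in> hitting_sets l u {} {S1 \<inter> S2}"
    and U0: "\<forall>t>0. min (icard ({j. t \<le> c j} - {})) (u - missed {j. t \<le> c j} (S1 \<inter> S2))
       \<le> icard (A0 \<inter> {j. t \<le> c j})"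
    and L0: "\<forall>t<0. min (icard (- {j. c j \<le> t} - {})) (l - missed (- {j. c j \<le> t}) (S1 \<inter> S2))
       \<le> l - icard (A0 \<inter> {j. c j \<le> t})"
    using hitting_set_maximizer[where c = c and m = "\<lambda>R. missed R (S1 \<inter> S2)", OF fam0] by blast
  \<comment> \<open>Two members have to be hit here; \<open>u \<ge> 2\<close> provides the
    capacity.\<close>
  have fam1: "disjoint {S1 - S2, S2 - S1}" "{} \<notin> {S1 - S2, S2 - S1}" "\<And>T. T \<in> {S1 - S2, S2 - S1} \<Longrightarrow> T \<inter> (S1 \<inter> S2) = {}"
    "l \<le> u" "icard {S1 - S2, S2 - S1} \<le> u" "l \<le> icard (- (S1 \<inter> S2))"
    "\<And>R. icard {T \<in> {S1 - S2, S2 - S1}. R \<inter> T = {}} = (missed R (S1 - S2) + missed R (S2 - S1))"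
    using meet diff ne12 lu lS[of "S1 \<inter> S2"] icard_missed(3)[OF ne12] by (auto simp: disjoint_def)
  obtain A1 where A1: "A1 \<in> hitting_sets l u (S1 \<inter> S2) {S1 - S2, S2 - S1}"
    and U1: "\<forall>t>0. min (icard ({j. t \<le> c j} - (S1 \<inter> S2))) (u - (missed {j. t \<le> c j} (S1 - S2) + missed {j. t \<le> c j} (S2 - S1)))
       \<le> icard (A1 \<inter> {j. t \<le> c j})"
    and L1: "\<forall>t<0. min (icard (- {j. c j \<le> t} - (S1 \<inter> S2))) (l - (missed (- {j. c j \<le> t}) (S1 - S2) + missed (- {j. c j \<le> t}) (S2 - S1)))
       \<le> l - icard (A1 \<inter> {j. c j \<le> t})"
    using hitting_set_maximizer[where c = c and m = "\<lambda>R. (missed R (S1 - S2) + missed R (S2 - S1))", OF fam1] by blast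
  have fam2: "disjoint {S2 - S1}" "{} \<notin> {S2 - S1}" "\<And>T. T \<in> {S2 - S1} \<Longrightarrow> T \<inter> S1 = {}"
    "l \<le> u" "icard {S2 - S1} \<le> u" "l \<le> icard (- S1)"
    "\<And>R. icard {T \<in> {S2 - S1}. R \<inter> T = {}} = missed R (S2 - S1)"
    using meet diff ne12 lu lS[of S1] icard_missed(2) by (auto simp: disjoint_def)
  obtain A2 where A2: "A2 \<in> hitting_sets l u S1 {S2 - S1}"
    and U2: "\<forall>t>0. min (icard ({j. t \<le> c j} - S1)) (u - missed {j. t \<le> c j} (S2 - S1))
       \<le> icard (A2 \<inter> {j. t \<le> c j})"
    and L2: "\<forall>t<0. min (icard (- {j. c j \<le> t} - S1)) (l - missed (- {j. c j \<le> t}) (S2 - S1))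
       \<le> l - icard (A2 \<inter> {j. c j \<le> t})"
    using hitting_set_maximizer[where c = c and m = "\<lambda>R. missed R (S2 - S1)", OF fam2] by blast
  have fam3: "disjoint {S1 - S2}" "{} \<notin> {S1 - S2}" "\<And>T. T \<in> {S1 - S2} \<Longrightarrow> T \<inter> S2 = {}"
    "l \<le> u" "icard {S1 - S2} \<le> u" "l \<le> icard (- S2)"
    "\<And>R. icard {T \<in> {S1 - S2}. R \<inter> T = {}} = missed R (S1 - S2)"
    using meet diff ne12 lu lS[of S2] icard_missed(2) by (auto simp: disjoint_def)
  obtain A3 where A3: "A3 \<in> hitting_sets l u S2 {S1 - S2}"
    and U3: "\<forall>t>0. min (icard ({j. t \<le> c j} - S2)) (u - missed {j. t \<le> c j} (S1 - S2))
       \<le> icard (A3 \<inter> {j. t \<le> c j})"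
    and L3: "\<forall>t<0. min (icard (- {j. c j \<le> t} - S2)) (l - missed (- {j. c j \<le> t}) (S1 - S2))
       \<le> l - icard (A3 \<inter> {j. c j \<le> t})"
    using hitting_set_maximizer[where c = c and m = "\<lambda>R. missed R (S1 - S2)", OF fam3] by blast
  have fam4: "disjoint ({} :: 'a set set)" "{} \<notin> ({} :: 'a set set)" "\<And>T. T \<in> ({} :: 'a set set) \<Longrightarrow> T \<inter> (S1 \<union> S2) = {}"
    "l \<le> u" "icard ({} :: 'a set set) \<le> u" "l \<le> icard (- (S1 \<union> S2))"
    "\<And>R. icard {T \<in> ({} :: 'a set set). R \<inter> T = {}} = 0"
    using meet diff ne12 lu le_Un icard_missed(1) by (auto simp: disjoint_def)
  obtain A4 where A4: "A4 \<in> hitting_sets l u (S1 \<union> S2) {}"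
    and U4: "\<forall>t>0. min (icard ({j. t \<le> c j} - (S1 \<union> S2))) (u - 0)
       \<le> icard (A4 \<inter> {j. t \<le> c j})"
    and L4: "\<forall>t<0. min (icard (- {j. c j \<le> t} - (S1 \<union> S2))) (l - 0)
       \<le> l - icard (A4 \<inter> {j. c j \<le> t})"
    using hitting_set_maximizer[where c = c and m = "\<lambda>R. 0", OF fam4] by blast

  \<comment> \<open>The \<open>z\<close>-part of the combination of the five maximisers with the
    weights forced by \<open>\<delta>\<close>.\<close>
  define y :: "'a \<Rightarrow> real" where "y j = pattern_sum d0 d1 d2 d3 (of_bool (j \<in> A0)) (of_bool (j \<in> A1))
    (of_bool (j \<in> A2)) (of_bool (j \<in> A3)) (of_bool (j \<in> A4))" for j
  have sum_y: "sum y Q = pattern_sum d0 d1 d2 d3 (icard (A0 \<inter> Q)) (icard (A1 \<inter> Q)) (icard (A2 \<inter> Q))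
      (icard (A3 \<inter> Q)) (icard (A4 \<inter> Q))" for Q
    unfolding y_def pattern_sum_def sum.distrib sum_distrib_left[symmetric]
    by (simp only: of_int_of_bool sum_of_bool_mem of_int_of_nat_eq)
  have "(\<Sum>j\<in>UNIV. c j * z $ j) \<le> (\<Sum>j\<in>UNIV. c j * y j)"
  proof (rule sum_mult_le_of_level_sets)
    fix t :: real assume t: "0 < t"
    show "sum (($) z) {j. t \<le> c j} \<le> sum y {j. t \<le> c j}"
      unfolding sum_y
      by (rule U.pattern_sum_mono[OF U.F_le_pattern_bound[unfolded U.pattern_bound_def]
            U0[rule_format, OF t, unfolded Diff_empty] U1[rule_format, OF t] U2[rule_format, OF t] U3[rule_format, OF t] U4[rule_format, OF t, unfolded diff_zero]])
  next
    fix t :: real assume t: "t < 0"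
    \<comment> \<open>The bound is used for the complement of the lower level set. As the weights
      add up to 1, \<open>l\<close> cancels and the inequality reverses.\<close>
    have "of_int l - sum (($) z) (- (- {j. c j \<le> t})) \<le> pattern_sum d0 d1 d2 d3
        (l - icard (A0 \<inter> {j. c j \<le> t})) (l - icard (A1 \<inter> {j. c j \<le> t}))
        (l - icard (A2 \<inter> {j. c j \<le> t})) (l - icard (A3 \<inter> {j. c j \<le> t}))
        (l - icard (A4 \<inter> {j. c j \<le> t}))"
      by (rule L.pattern_sum_mono[OF L.F_le_pattern_bound[unfolded L.pattern_bound_def]
            L0[rule_format, OF t, unfolded Diff_empty] L1[rule_format, OF t] L2[rule_format, OF t] L3[rule_format, OF t] L4[rule_format, OF t, unfolded diff_zero]])
    then show "sum y {j. c j \<le> t} \<le> sum (($) z) {j. c j \<le> t}"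
      unfolding sum_y by (simp add: pattern_sum_def algebra_simps)
  qed
  then have snd_le: "snd a \<bullet> (\<chi> j. y j) \<le> snd a \<bullet> z"
    by (simp add: inner_vec_def c_def sum_negf)

  \<comment> \<open>The combination reproduces \<open>\<delta>\<close> exactly and has
    \<open>y\<close> as second part, so the functional at \<open>p\<close> is at most its value at
    the separated point, although all five vectors lie in the hull.\<close>
  define p where "p = (1 - d0) *\<^sub>R incidence S1 S2 A0 + (d0 - d1 - d2 + d3) *\<^sub>R incidence S1 S2 A1
    + (d1 - d3) *\<^sub>R incidence S1 S2 A2 + (d2 - d3) *\<^sub>R incidence S1 S2 A3
    + d3 *\<^sub>R incidence S1 S2 A4"
  have "fst p = \<delta>"
    unfolding p_def fst_add fst_scaleR fst_incidence(1)[OF meet A0] fst_incidence(2)[OF meet A1]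
      fst_incidence(3)[OF meet A2] fst_incidence(4)[OF meet A3] fst_incidence(5)[OF meet A4]
      vec_eq_iff all_4 d_def by simp
  moreover have "snd p = (\<chi> j. y j)"
    unfolding p_def y_def by (simp add: incidence_def pattern_sum_def vec_eq_iff)
  ultimately have "p = (\<delta>, \<chi> j. y j)" by (simp add: prod_eq_iff)
  then have le: "a \<bullet> p \<le> a \<bullet> (\<delta>, z)" using snd_le by (cases a) simp
  have ge: "b \<le> a \<bullet> incidence S1 S2 A" if "A \<in> hitting_sets l u Z \<T>" for A Z \<T>
    using ab(2)[OF hull_inc[OF incidence_hitting_sets[OF that]]] by simp
  \<comment> \<open>The bound \<open>b\<close> is split by the five weights, whose sum is 1.\<close>
  have "(1 - d0) * b + (d0 - d1 - d2 + d3) * b + (d1 - d3) * b + (d2 - d3) * b + d3 * b \<le> a \<bullet> p"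
    unfolding p_def inner_add_right inner_scaleR_right
    using d ge[OF A0] ge[OF A1] ge[OF A2] ge[OF A3] ge[OF A4]
    by (intro add_mono mult_left_mono) auto
  then have "b \<le> a \<bullet> p" by (simp add: algebra_simps)
  with le show False using ab(1) by linarith
qed

theorem theorem11:
  fixes l u :: int and S1 S2 :: "'a::finite set"
  assumes "l \<ge> 0" and "u \<ge> 2" and "u \<ge> l + 1"
    and "2 \<le> icard S1" and "icard S1 \<le> int CARD('a) - l"
    and "2 \<le> icard S2" and "icard S2 \<le> int CARD('a) - l"
    and "S1 - S2 \<noteq> {}" and "S2 - S1 \<noteq> {}"
    and "S1 \<inter> S2 \<noteq> {}" and "icard (S1 \<union> S2) \<le> int CARD('a) - l"
  shows "convex hull (X_bar l u S1 S2) =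
    {(\<delta>, z). ineqs_A \<delta> \<and> ineqs_B l u (S_fam S1 S2) \<delta> z \<and>
       (\<forall>Q. ineqs_C u (S_fam S1 S2) \<delta> z Q) \<and> (\<forall>Q. ineqs_D l (S_fam S1 S2) \<delta> z Q)}"
    (is "_ = ?P")
proof
  have "X_bar l u S1 S2 \<subseteq> ?P" unfolding X_bar_eq by (intro image_subsetI incidence_ineqs) auto
  then show "convex hull (X_bar l u S1 S2) \<subseteq> ?P" by (intro hull_minimal convex_ineqs)
  show "?P \<subseteq> convex hull (X_bar l u S1 S2)"
    using ineqs_imp_hull[OF assms(1-3,8-11)] by blast
qed

end
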